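(* Let $T$ be a stable complete first-order theory and $M\models T$. Then for every $L$-formula $\phi(x;y)$ and all $r<s$ there is a natural number $N$ such that there are no sequences $(\mu_1,\ldots,\mu_N)$ and $(\nu_1,\ldots,\nu_N)$ of average measures of elements of $M$ (in the variables $x$ and $y$ respectively) with $\mu_i\otimes\nu_j(\phi(x;y))\le r$ whenever $i<j$ and $\mu_i\otimes\nu_j(\phi(x;y))\ge s$ otherwise.
   Context: For $a_1,\dots,a_k\in M$, the average measure $\mu={\rm Ave}(a_1,\dots,a_k)$ is given by $\mu(\phi(x;b))=\frac1k|\{j\le k: M\models\phi(a_j;b)\}|$; similarly for averages in the variable $y$. For $\mu={\rm Ave}(a_1,\dots,a_k)$ and $\nu={\rm Ave}(b_1,\dots,b_k)$, $\mu\otimes\nu(\phi(x;y))=\frac1{k^2}\sum_{i\le k}\sum_{j\le k}\phi(a_i;b_j)$, where $\phi(a;b)$ is $1$ if $M\models\phi(a;b)$ and $0$ otherwise. *)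

theory Defs
  imports Complex_Main
begin

section \<open>First-order logic with equality\<close>

text \<open>The symbols of a language are those in the domain of the arity maps, so that either kind
  of symbol may be absent.\<close>

record ('f, 'r) language =
  fun_arity :: "'f \<Rightarrow> nat option"
  rel_arity :: "'r \<Rightarrow> nat option"

datatype 'f tm = Var nat | Fun 'f "'f tm list"

datatype ('f, 'r) fm =
    Eq "'f tm" "'f tm"
  | Rel 'r "'f tm list"
  | Neg "('f, 'r) fm"
  | Conj "('f, 'r) fm" "('f, 'r) fm"
  | Exists nat "('f, 'r) fm"

fun wf_tm :: "('f, 'r) language \<Rightarrow> 'f tm \<Rightarrow> bool" where
  "wf_tm L (Var n) = True"
| "wf_tm L (Fun f ts) = (fun_arity L f = Some (length ts) \<and> (\<forall>t\<in>set ts. wf_tm L t))"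

fun wf_fm :: "('f, 'r) language \<Rightarrow> ('f, 'r) fm \<Rightarrow> bool" where
  "wf_fm L (Eq t u) = (wf_tm L t \<and> wf_tm L u)"
| "wf_fm L (Rel R ts) = (rel_arity L R = Some (length ts) \<and> (\<forall>t\<in>set ts. wf_tm L t))"
| "wf_fm L (Neg \<phi>) = wf_fm L \<phi>"
| "wf_fm L (Conj \<phi> \<psi>) = (wf_fm L \<phi> \<and> wf_fm L \<psi>)"
| "wf_fm L (Exists n \<phi>) = wf_fm L \<phi>"

fun fv_tm :: "'f tm \<Rightarrow> nat set" where
  "fv_tm (Var n) = {n}"
| "fv_tm (Fun f ts) = (\<Union>t\<in>set ts. fv_tm t)"

fun fv :: "('f, 'r) fm \<Rightarrow> nat set" where
  "fv (Eq t u) = fv_tm t \<union> fv_tm u"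
| "fv (Rel R ts) = (\<Union>t\<in>set ts. fv_tm t)"
| "fv (Neg \<phi>) = fv \<phi>"
| "fv (Conj \<phi> \<psi>) = fv \<phi> \<union> fv \<psi>"
| "fv (Exists n \<phi>) = fv \<phi> - {n}"

definition sentence :: "('f, 'r) language \<Rightarrow> ('f, 'r) fm \<Rightarrow> bool" where
  "sentence L \<phi> \<longleftrightarrow> wf_fm L \<phi> \<and> fv \<phi> = {}"

record ('a, 'f, 'r) struct =
  dom_of :: "'a set"
  fun_of :: "'f \<Rightarrow> 'a list \<Rightarrow> 'a"
  rel_of :: "'r \<Rightarrow> 'a list \<Rightarrow> bool"

definition is_struct :: "('f, 'r) language \<Rightarrow> ('a, 'f, 'r) struct \<Rightarrow> bool" where
  "is_struct L M \<longleftrightarrow> dom_of M \<noteq> {} \<and>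
     (\<forall>f as. fun_arity L f = Some (length as) \<and> set as \<subseteq> dom_of M \<longrightarrow> fun_of M f as \<in> dom_of M)"

fun eval :: "('a, 'f, 'r) struct \<Rightarrow> (nat \<Rightarrow> 'a) \<Rightarrow> 'f tm \<Rightarrow> 'a" where
  "eval M v (Var n) = v n"
| "eval M v (Fun f ts) = fun_of M f (map (eval M v) ts)"

fun sat :: "('a, 'f, 'r) struct \<Rightarrow> (nat \<Rightarrow> 'a) \<Rightarrow> ('f, 'r) fm \<Rightarrow> bool" where
  "sat M v (Eq t u) = (eval M v t = eval M v u)"
| "sat M v (Rel R ts) = rel_of M R (map (eval M v) ts)"
| "sat M v (Neg \<phi>) = (\<not> sat M v \<phi>)"
| "sat M v (Conj \<phi> \<psi>) = (sat M v \<phi> \<and> sat M v \<psi>)"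
| "sat M v (Exists n \<phi>) = (\<exists>a\<in>dom_of M. sat M (v(n := a)) \<phi>)"

definition satisfies :: "('a, 'f, 'r) struct \<Rightarrow> ('f, 'r) fm \<Rightarrow> bool" where
  "satisfies M \<phi> \<longleftrightarrow> (\<forall>v. range v \<subseteq> dom_of M \<longrightarrow> sat M v \<phi>)"

definition model_of ::
  "('f, 'r) language \<Rightarrow> ('f, 'r) fm set \<Rightarrow> ('a, 'f, 'r) struct \<Rightarrow> bool" where
  "model_of L T M \<longleftrightarrow> is_struct L M \<and> (\<forall>\<sigma>\<in>T. satisfies M \<sigma>)"


section \<open>Complete theories and stable theories\<close>

text \<open>A definition in HOL cannot quantify over the models of a theory on all types. Below, the
  models considered are those whose domain is a subset of the type of formulas. That type has
  at least \<open>|L| + \<aleph>\<^sub>0\<close> elements, so by the downward Loewenheim-Skolem theorem every model on any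
  type has an elementary substructure, containing any prescribed countable set, that is
  isomorphic to one of the models considered. Hence entailment, satisfiability and the absence
  of the order property have the same meaning as with quantification over all models.\<close>

type_synonym ('f, 'r) small_struct = "(('f, 'r) fm, 'f, 'r) struct"

definition entails :: "('f, 'r) language \<Rightarrow> ('f, 'r) fm set \<Rightarrow> ('f, 'r) fm \<Rightarrow> bool" where
  "entails L T \<sigma> \<longleftrightarrow> (\<forall>M :: ('f, 'r) small_struct. model_of L T M \<longrightarrow> satisfies M \<sigma>)"

definition complete_theory :: "('f, 'r) language \<Rightarrow> ('f, 'r) fm set \<Rightarrow> bool" where
  "complete_theory L T \<longleftrightarrow>
     (\<forall>\<sigma>\<in>T. sentence L \<sigma>) \<and>
     (\<exists>M :: ('f, 'r) small_struct. model_of L T M) \<and>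
     (\<forall>\<sigma>. sentence L \<sigma> \<longrightarrow> entails L T \<sigma> \<or> entails L T (Neg \<sigma>))"

text \<open>An \<open>L\<close>-formula \<open>\<phi>(x; y)\<close>, where \<open>x\<close> and \<open>y\<close> are finite tuples of variables.\<close>

definition split_fm ::
  "('f, 'r) language \<Rightarrow> ('f, 'r) fm \<Rightarrow> nat list \<Rightarrow> nat list \<Rightarrow> bool" where
  "split_fm L \<phi> x y \<longleftrightarrow> wf_fm L \<phi> \<and> distinct (x @ y) \<and> fv \<phi> \<subseteq> set (x @ y)"

definition tuples :: "('a, 'f, 'r) struct \<Rightarrow> nat list \<Rightarrow> 'a list set" where
  "tuples M x = {a. length a = length x \<and> set a \<subseteq> dom_of M}"

definition assign :: "nat list \<Rightarrow> 'a list \<Rightarrow> nat \<Rightarrow> 'a" where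
  "assign x a n = (case map_of (zip x a) n of Some c \<Rightarrow> c | None \<Rightarrow> undefined)"

text \<open>\<open>M \<Turnstile> \<phi>(a; b)\<close>, with \<open>a\<close> substituted for \<open>x\<close> and \<open>b\<close> for \<open>y\<close>.\<close>

definition holds ::
  "('a, 'f, 'r) struct \<Rightarrow> ('f, 'r) fm \<Rightarrow> nat list \<Rightarrow> 'a list \<Rightarrow> nat list \<Rightarrow> 'a list \<Rightarrow> bool" where
  "holds M \<phi> x a y b \<longleftrightarrow> sat M (assign (x @ y) (a @ b)) \<phi>"

definition order_property ::
  "('a, 'f, 'r) struct \<Rightarrow> ('f, 'r) fm \<Rightarrow> nat list \<Rightarrow> nat list \<Rightarrow> bool" where
  "order_property M \<phi> x y \<longleftrightarrow>
     (\<exists>a b :: nat \<Rightarrow> 'a list. (\<forall>i. a i \<in> tuples M x) \<and> (\<forall>i. b i \<in> tuples M y) \<and>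
        (\<forall>i j. holds M \<phi> x (a i) y (b j) \<longleftrightarrow> i < j))"

definition stable_theory :: "('f, 'r) language \<Rightarrow> ('f, 'r) fm set \<Rightarrow> bool" where
  "stable_theory L T \<longleftrightarrow>
     (\<forall>(M :: ('f, 'r) small_struct) \<phi> x y.
        model_of L T M \<and> split_fm L \<phi> x y \<longrightarrow> \<not> order_property M \<phi> x y)"


section \<open>Average measures\<close>

text \<open>A measure in the variables \<open>x\<close> is a function \<open>\<mu>\<close>, where \<open>\<mu> \<phi> y b\<close> is the measure of the
  formula \<open>\<phi>(x; b)\<close> with the parameters \<open>b\<close> substituted for \<open>y\<close>. For a measure \<open>\<nu>\<close> in the
  variables \<open>y\<close>, the measure of \<open>\<phi>(a; y)\<close> is accordingly \<open>\<nu> \<phi> x a\<close>.\<close>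

type_synonym ('a, 'f, 'r) fm_measure = "('f, 'r) fm \<Rightarrow> nat list \<Rightarrow> 'a list \<Rightarrow> real"

definition Ave :: "('a, 'f, 'r) struct \<Rightarrow> nat list \<Rightarrow> 'a list list \<Rightarrow> ('a, 'f, 'r) fm_measure" where
  "Ave M x as \<phi> y b = real (card {j. j < length as \<and> holds M \<phi> x (as ! j) y b}) / real (length as)"

definition average_measure ::
  "('a, 'f, 'r) struct \<Rightarrow> nat list \<Rightarrow> ('a, 'f, 'r) fm_measure \<Rightarrow> bool" where
  "average_measure M x \<mu> \<longleftrightarrow> (\<exists>as. as \<noteq> [] \<and> set as \<subseteq> tuples M x \<and> \<mu> = Ave M x as)"

text \<open>The value of \<open>\<mu> \<otimes> \<nu>\<close> at \<open>\<phi>(x; y)\<close> is defined by means of representations of \<open>\<mu>\<close> and \<open>\<nu>\<close>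
  as averages of the same number of tuples. Such representations exist, by repetition of tuples,
  and the value does not depend on them: see \<open>tensor_Ave\<close>.\<close>

definition tensor ::
  "('a, 'f, 'r) struct \<Rightarrow> nat list \<Rightarrow> nat list \<Rightarrow>
     ('a, 'f, 'r) fm_measure \<Rightarrow> ('a, 'f, 'r) fm_measure \<Rightarrow> ('f, 'r) fm \<Rightarrow> real" where
  "tensor M x y \<mu> \<nu> \<phi> =
     (THE c. \<exists>k as bs. 0 < k \<and> length as = k \<and> length bs = k \<and>
        set as \<subseteq> tuples M x \<and> set bs \<subseteq> tuples M y \<and> \<mu> = Ave M x as \<and> \<nu> = Ave M y bs \<and>
        c = 1 / (real k)\<^sup>2 * (\<Sum>i<k. \<Sum>j<k. of_bool (holds M \<phi> x (as ! i) y (bs ! j))))"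

lemma holds_swap:
  assumes "distinct (x @ y)" "length a = length x" "length b = length y"
  shows "holds M \<phi> y b x a = holds M \<phi> x a y b"
proof -
  have d: "dom (map_of (zip x a)) = set x" "dom (map_of (zip y b)) = set y"
    using assms(2,3) by (simp_all add: dom_map_of_zip)
  have "map_of (zip x a) ++ map_of (zip y b) = map_of (zip y b) ++ map_of (zip x a)"
    by (rule map_add_comm) (use assms(1) d in auto)
  then have "map_of (zip (y @ x) (b @ a)) = map_of (zip (x @ y) (a @ b))"
    using assms(2,3) by simp
  then have "assign (y @ x) (b @ a) = assign (x @ y) (a @ b)"
    unfolding assign_def by presburger
  then show ?thesis by (simp add: holds_def)
qed

lemma Ave_sum:
  "Ave M x as \<phi> y b = (\<Sum>i<length as. of_bool (holds M \<phi> x (as ! i) y b)) / real (length as)"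
proof -
  have "{..<length as} \<inter> {j. holds M \<phi> x (as ! j) y b}
      = {j. j < length as \<and> holds M \<phi> x (as ! j) y b}" by auto
  then show ?thesis by (simp add: Ave_def)
qed

lemma Ave_sum_list:
  "Ave M x as \<phi> y b = (\<Sum>a\<leftarrow>as. of_bool (holds M \<phi> x a y b)) / real (length as)"
  by (simp add: Ave_sum sum_list_sum_nth atLeast0LessThan)

lemma Ave_replicate:
  fixes as :: "'a list list"
  assumes "0 < n"
  shows "Ave M x (concat (replicate n as)) = Ave M x as"
proof -
  have len: "length (concat (replicate n as)) = n * length as" by (induction n) auto
  have "(\<Sum>a\<leftarrow>concat (replicate n as). f a) = real n * (\<Sum>a\<leftarrow>as. f a)" for f :: "'a list \<Rightarrow> real"
    by (induction n) (auto simp: algebra_simps)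
  with assms show ?thesis by (intro ext) (simp add: Ave_sum_list len)
qed

lemma double_average_cong:
  assumes xy: "distinct (x @ y)"
    and as: "set as \<subseteq> tuples M x" "set as' \<subseteq> tuples M x" "Ave M x as = Ave M x as'"
    and bs: "set bs \<subseteq> tuples M y" "set bs' \<subseteq> tuples M y" "Ave M y bs = Ave M y bs'"
  shows "(\<Sum>i<length as. \<Sum>j<length bs. of_bool (holds M \<phi> x (as ! i) y (bs ! j)))
           / (real (length as) * real (length bs))
       = (\<Sum>i<length as'. \<Sum>j<length bs'. of_bool (holds M \<phi> x (as' ! i) y (bs' ! j)))
           / (real (length as') * real (length bs'))"
    (is "?P as bs = ?P as' bs'")
proof -
  have l: "?P cs ds = (\<Sum>j<length ds. Ave M x cs \<phi> y (ds ! j)) / real (length ds)" for cs ds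
    by (subst sum.swap) (simp add: Ave_sum sum_divide_distrib)
  have r: "?P cs ds = (\<Sum>i<length cs. Ave M y ds \<phi> x (cs ! i)) / real (length cs)"
    if "set cs \<subseteq> tuples M x" "set ds \<subseteq> tuples M y" for cs ds
  proof -
    have "holds M \<phi> y (ds ! j) x (cs ! i) = holds M \<phi> x (cs ! i) y (ds ! j)"
      if "i < length cs" "j < length ds" for i j
    proof (rule holds_swap[OF xy])
      have "cs ! i \<in> tuples M x" "ds ! j \<in> tuples M y"
        using that \<open>set cs \<subseteq> tuples M x\<close> \<open>set ds \<subseteq> tuples M y\<close> by (meson nth_mem subsetD)+
      then show "length (cs ! i) = length x" "length (ds ! j) = length y"
        by (simp_all add: tuples_def)
    qed
    then show ?thesis by (simp add: Ave_sum sum_divide_distrib mult.commute)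
  qed
  have "?P as bs = ?P as' bs" by (simp only: l as(3))
  also have "\<dots> = ?P as' bs'" using r[OF as(2) bs(1)] r[OF as(2) bs(2)] bs(3) by simp
  finally show ?thesis .
qed

lemma tensor_Ave:
  assumes xy: "distinct (x @ y)"
    and as: "as \<noteq> []" "set as \<subseteq> tuples M x" and bs: "bs \<noteq> []" "set bs \<subseteq> tuples M y"
  shows "tensor M x y (Ave M x as) (Ave M y bs) \<phi> =
     (\<Sum>i<length as. \<Sum>j<length bs. of_bool (holds M \<phi> x (as ! i) y (bs ! j)))
       / (real (length as) * real (length bs))" (is "_ = ?c")
  unfolding tensor_def
proof (rule the_equality)
  have len: "length (concat (replicate n zs)) = n * length zs" for n and zs :: "'a list list"
    by (induction n) auto
  define as' where "as' = concat (replicate (length bs) as)"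
  define bs' where "bs' = concat (replicate (length as) bs)"
  define k where "k = length as * length bs"
  have k: "0 < k" "length as' = k" "length bs' = k"
    using as(1) bs(1) by (simp_all add: k_def as'_def bs'_def len mult.commute)
  have sets: "set as' \<subseteq> tuples M x" "set bs' \<subseteq> tuples M y"
    using as bs by (auto simp: as'_def bs'_def)
  have ave: "Ave M x as = Ave M x as'" "Ave M y bs = Ave M y bs'"
    using as(1) bs(1) by (simp_all add: as'_def bs'_def Ave_replicate)
  have "?c = 1 / (real k)\<^sup>2 * (\<Sum>i<k. \<Sum>j<k. of_bool (holds M \<phi> x (as' ! i) y (bs' ! j)))"
    using double_average_cong[OF xy as(2) sets(1) ave(1) bs(2) sets(2) ave(2), of \<phi>]
    by (simp only: k power2_eq_square) simp
  with k sets ave show "\<exists>k as' bs'. 0 < k \<and> length as' = k \<and> length bs' = k \<and>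
      set as' \<subseteq> tuples M x \<and> set bs' \<subseteq> tuples M y \<and>
      Ave M x as = Ave M x as' \<and> Ave M y bs = Ave M y bs' \<and>
      ?c = 1 / (real k)\<^sup>2 * (\<Sum>i<k. \<Sum>j<k. of_bool (holds M \<phi> x (as' ! i) y (bs' ! j)))"
    by blast
next
  fix c
  assume "\<exists>k as' bs'. 0 < k \<and> length as' = k \<and> length bs' = k \<and>
      set as' \<subseteq> tuples M x \<and> set bs' \<subseteq> tuples M y \<and>
      Ave M x as = Ave M x as' \<and> Ave M y bs = Ave M y bs' \<and>
      c = 1 / (real k)\<^sup>2 * (\<Sum>i<k. \<Sum>j<k. of_bool (holds M \<phi> x (as' ! i) y (bs' ! j)))"
  then obtain k as' bs' where h: "length as' = k" "length bs' = k"
      "set as' \<subseteq> tuples M x" "set bs' \<subseteq> tuples M y"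
      "Ave M x as = Ave M x as'" "Ave M y bs = Ave M y bs'"
      "c = 1 / (real k)\<^sup>2 * (\<Sum>i<k. \<Sum>j<k. of_bool (holds M \<phi> x (as' ! i) y (bs' ! j)))"
    by blast
  show "c = ?c"
    using double_average_cong[OF xy as(2) h(3,5) bs(2) h(4,6), of \<phi>] h(1,2,7)
    by (simp add: power2_eq_square)
qed

end

theory Submission
  imports Defs "HOL-Library.Countable_Set"
begin

text \<open>Stability bounds the length of the half graphs of \<open>\<phi>\<close> in \<open>M\<close>: otherwise an ultrapower of \<open>M\<close>
  has the order property, and so has a Skolem hull of countably many of its elements, coded by
  formulas. A bound on half graphs bounds the depth of the binary trees (Littlestone trees)
  shattered by \<open>\<phi>\<close>.

  A half graph of length \<open>2 ^ m\<close> between averages gives, by binary search, a complete tree of depth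
  \<open>m\<close> with nodes labelled by averages \<open>\<nu>\<close> and leaves by averages \<open>\<mu>\<close>, such that along every branch
  the signed deviations from \<open>(r + s) / 2\<close> add up to at least \<open>m (s - r) / 2\<close>. This sum is affine
  in \<open>\<mu>\<close>, so at each leaf \<open>\<mu>\<close> can be replaced by one tuple. The exponential moment of these sums
  over the leaves is convex in the labels of the nodes, so it is bounded as if the labels were
  single tuples, where the Sauer-Shelah argument for Littlestone trees of bounded depth applies: it
  is at most polynomial in \<open>m\<close> times the moment of a random walk. This is a contradiction for
  large \<open>m\<close>.\<close>

section \<open>Averages over lists\<close>

definition avg :: "'b list \<Rightarrow> ('b \<Rightarrow> real) \<Rightarrow> real" where
  "avg bs f = (\<Sum>b\<leftarrow>bs. f b) / real (length bs)"

lemma avg_le: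
  assumes "bs \<noteq> []" "\<And>b. b \<in> set bs \<Longrightarrow> f b \<le> C"
  shows "avg bs f \<le> C"
proof -
  have "(\<Sum>b\<leftarrow>bs. f b) \<le> (\<Sum>b\<leftarrow>bs. C)"
    by (rule sum_list_mono) (use assms in auto)
  then show ?thesis
    using assms(1) by (simp add: avg_def sum_list_triv field_simps)
qed

lemma avg_add: "avg bs (\<lambda>b. f b + g b) = avg bs f + avg bs g"
  by (simp add: avg_def sum_list_addf add_divide_distrib)

lemma avg_cmult: "avg bs (\<lambda>b. c * f b) = c * avg bs f"
  by (simp add: avg_def sum_list_const_mult)

lemma avg_const: "bs \<noteq> [] \<Longrightarrow> avg bs (\<lambda>b. c) = c"
  by (simp add: avg_def sum_list_triv)

lemma avg_mono:
  assumes "\<And>b. b \<in> set bs \<Longrightarrow> f b \<le> g b"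
  shows "avg bs f \<le> avg bs g"
  unfolding avg_def by (rule divide_right_mono[OF sum_list_mono[OF assms]]) auto

lemma avg_sum: "avg bs (\<lambda>b. \<Sum>i\<in>I. f i b) = (\<Sum>i\<in>I. avg bs (f i))"
proof (induction I rule: infinite_finite_induct)
  case (insert i I)
  then show ?case by (simp add: avg_add)
qed (auto simp: avg_def)

text \<open>Jensen's inequality: the tangent of \<open>exp\<close> at the mean \<open>\<mu>\<close>
  lies below the graph and averages to \<open>exp \<mu>\<close>.\<close>

lemma exp_avg_le:
  assumes "bs \<noteq> []"
  shows "exp (avg bs f) \<le> avg bs (\<lambda>b. exp (f b))"
proof -
  define \<mu> where "\<mu> = avg bs f"
  have "exp \<mu> * (1 + (f b - \<mu>)) \<le> exp (f b)" for b
    using mult_left_mono[OF exp_ge_add_one_self[of "f b - \<mu>"], of "exp \<mu>"]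
    by (simp add: exp_diff)
  then have "avg bs (\<lambda>b. exp \<mu> * (1 + (f b - \<mu>))) \<le> avg bs (\<lambda>b. exp (f b))"
    by (intro avg_mono)
  moreover have "avg bs (\<lambda>b. exp \<mu> * (1 + (f b - \<mu>))) = exp \<mu>"
  proof -
    have "avg bs (\<lambda>b. (1 - \<mu>) + f b) = 1"
      using assms by (simp only: avg_add) (simp add: \<mu>_def avg_const)
    then show ?thesis by (simp only: avg_cmult) (simp add: algebra_simps)
  qed
  ultimately show ?thesis by (simp add: \<mu>_def)
qed

section \<open>Littlestone trees and ladders\<close>

text \<open>Littlestone dimension (Shelah's 2-rank) of \<open>A\<close>: a complete binary tree of
  depth \<open>n\<close> with labels in \<open>B\<close>, every branch of which is realised in
  \<open>A\<close>. Only \<open>A\<close> shrinks along a branch.\<close>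

fun littlestone_ge :: "('a \<Rightarrow> 'b \<Rightarrow> bool) \<Rightarrow> nat \<Rightarrow> 'a set \<Rightarrow> 'b set \<Rightarrow> bool" where
  "littlestone_ge \<phi> 0 A B \<longleftrightarrow> A \<noteq> {}"
| "littlestone_ge \<phi> (Suc n) A B \<longleftrightarrow>
     (\<exists>b\<in>B. littlestone_ge \<phi> n {a\<in>A. \<phi> a b} B \<and> littlestone_ge \<phi> n {a\<in>A. \<not> \<phi> a b} B)"

lemma littlestone_ge_mono:
  "littlestone_ge \<phi> n A B \<Longrightarrow> A \<subseteq> A' \<Longrightarrow> B \<subseteq> B' \<Longrightarrow> littlestone_ge \<phi> n A' B'"
proof (induction n arbitrary: A A')
  case (Suc n)
  then obtain b where b: "b \<in> B" "littlestone_ge \<phi> n {a\<in>A. \<phi> a b} B"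
    "littlestone_ge \<phi> n {a\<in>A. \<not> \<phi> a b} B" by auto
  have "littlestone_ge \<phi> n {a\<in>A'. \<phi> a b} B'" "littlestone_ge \<phi> n {a\<in>A'. \<not> \<phi> a b} B'"
    by (rule Suc.IH[OF b(2)] Suc.IH[OF b(3)]; use Suc.prems in blast)+
  then show ?case using b Suc.prems by auto
qed auto

lemma littlestone_ge_nonempty: "littlestone_ge \<phi> n A B \<Longrightarrow> A \<noteq> {}"
  by (induction n arbitrary: A) fastforce+

text \<open>The Ramsey property of trees whose nodes are coloured with two colours.\<close>

lemma littlestone_ge_Un:
  "littlestone_ge \<phi> (n + k) A (B \<union> C) \<Longrightarrow> littlestone_ge \<phi> n A B \<or> littlestone_ge \<phi> k A C"
proof (induction "n + k" arbitrary: n k A)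
  case 0
  then show ?case by simp
next
  case (Suc h)
  show ?case
  proof (cases "n = 0 \<or> k = 0")
    case True
    have "A \<noteq> {}" using Suc.prems by (rule littlestone_ge_nonempty)
    then show ?thesis using True by auto
  next
    case False
    then obtain n' k' where nk: "n = Suc n'" "k = Suc k'" by (metis not0_implies_Suc)
    obtain b where b: "b \<in> B \<union> C" "littlestone_ge \<phi> h {a\<in>A. \<phi> a b} (B \<union> C)"
      "littlestone_ge \<phi> h {a\<in>A. \<not> \<phi> a b} (B \<union> C)"
      using Suc.prems by (auto simp flip: Suc.hyps(2))
    have h: "h = n' + k" "h = n + k'" using Suc.hyps(2) nk by auto
    have sub: "littlestone_ge \<phi> i A D" if "littlestone_ge \<phi> i {a\<in>A. P a} D" for i P and D :: "'b set"
      using that by (rule littlestone_ge_mono) auto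
    \<comment> \<open>The colour of the root decides. If it is in \<open>B\<close>, either both
      subtrees contain an \<open>n'\<close>-tree over \<open>B\<close> and the root joins them, or
      one contains a \<open>k\<close>-tree over \<open>C\<close>.\<close>
    from b(1) show ?thesis
    proof
      assume "b \<in> B"
      moreover have "littlestone_ge \<phi> n' {a\<in>A. P a} B \<or> littlestone_ge \<phi> k A C"
        if "P = (\<lambda>a. \<phi> a b) \<or> P = (\<lambda>a. \<not> \<phi> a b)" for P
        using Suc.hyps(1)[of n' k "{a\<in>A. P a}"] that b(2,3) h(1) sub[of k P C] by auto
      ultimately show ?thesis unfolding nk(1) littlestone_ge.simps by blast
    next
      assume "b \<in> C"
      moreover have "littlestone_ge \<phi> n A B \<or> littlestone_ge \<phi> k' {a\<in>A. P a} C"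
        if "P = (\<lambda>a. \<phi> a b) \<or> P = (\<lambda>a. \<not> \<phi> a b)" for P
        using Suc.hyps(1)[of n k' "{a\<in>A. P a}"] that b(2,3) h(2) sub[of n P B] by auto
      ultimately show ?thesis unfolding nk(2) littlestone_ge.simps by blast
    qed
  qed
qed

text \<open>A half graph split into its first pair and the rest, the shape in which
  \<open>littlestone_ge_ladder\<close> builds it; \<open>ladder_sequences\<close> unrolls
  it.\<close>

fun ladder :: "('a \<Rightarrow> 'b \<Rightarrow> bool) \<Rightarrow> nat \<Rightarrow> 'a set \<Rightarrow> 'b set \<Rightarrow> bool" where
  "ladder \<phi> 0 A B \<longleftrightarrow> True"
| "ladder \<phi> (Suc n) A B \<longleftrightarrow>
     (\<exists>a\<in>A. \<exists>b\<in>B. \<phi> a b \<and> ladder \<phi> n {a'\<in>A. \<not> \<phi> a' b} {b'\<in>B. \<phi> a b'})"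

lemma ladder_mono:
  "ladder \<phi> n A B \<Longrightarrow> A \<subseteq> A' \<Longrightarrow> B \<subseteq> B' \<Longrightarrow> ladder \<phi> n A' B'"
proof (induction n arbitrary: A B A' B')
  case (Suc n)
  then obtain a b where ab: "a \<in> A" "b \<in> B" "\<phi> a b"
    "ladder \<phi> n {a'\<in>A. \<not> \<phi> a' b} {b'\<in>B. \<phi> a b'}" by auto
  have "ladder \<phi> n {a'\<in>A'. \<not> \<phi> a' b} {b'\<in>B'. \<phi> a b'}"
    by (rule Suc.IH[OF ab(4)]) (use Suc.prems in auto)
  then show ?case using ab Suc.prems by auto
qed auto

lemma ladder_sequences:
  assumes "ladder \<phi> n A B"
  shows "\<exists>a b. \<forall>i<n. a i \<in> A \<and> b i \<in> B \<and> (\<forall>j<n. \<phi> (a i) (b j) \<longleftrightarrow> i \<le> j)"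
  using assms
proof (induction n arbitrary: A B)
  case (Suc n)
  then obtain a\<^sub>0 b\<^sub>0 where 0: "a\<^sub>0 \<in> A" "b\<^sub>0 \<in> B" "\<phi> a\<^sub>0 b\<^sub>0"
    "ladder \<phi> n {a\<in>A. \<not> \<phi> a b\<^sub>0} {b\<in>B. \<phi> a\<^sub>0 b}" by auto
  obtain a b where ab: "\<forall>i<n. a i \<in> {a\<in>A. \<not> \<phi> a b\<^sub>0} \<and> b i \<in> {b\<in>B. \<phi> a\<^sub>0 b} \<and>
      (\<forall>j<n. \<phi> (a i) (b j) \<longleftrightarrow> i \<le> j)"
    using Suc.IH[OF 0(4)] by blast
  show ?case
    by (rule exI[of _ "case_nat a\<^sub>0 a"], rule exI[of _ "case_nat b\<^sub>0 b"])
      (use 0 ab in \<open>auto split: nat.split simp: less_Suc_eq_0_disj\<close>)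
qed auto

text \<open>Fix \<open>a\<close> in \<open>A\<close> and colour each label \<open>b\<close> by the
  truth of \<open>\<phi> a b\<close>. The Ramsey property leaves a deep tree of one colour; its root
  \<open>b\<close> and \<open>a\<close> form the first rung, and induction on \<open>p + q\<close>
  continues in the subtree on the side opposite to \<open>a\<close>. The depth is uniform in
  \<open>A\<close> and \<open>B\<close> because the induction passes to subsets.\<close>

lemma littlestone_ge_ladder:
  "\<exists>h. \<forall>A B. littlestone_ge \<phi> h A B \<longrightarrow> ladder \<phi> p A B \<or> ladder (\<lambda>a b. \<not> \<phi> a b) q A B"
proof (induction "p + q" arbitrary: p q)
  case (Suc t)
  show ?case
  proof (cases "p = 0 \<or> q = 0")
    case False
    then obtain p' q' where pq: "p = Suc p'" "q = Suc q'" by (metis not0_implies_Suc)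
    obtain h\<^sub>1 where h\<^sub>1: "\<And>A B. littlestone_ge \<phi> h\<^sub>1 A B \<Longrightarrow>
        ladder \<phi> p' A B \<or> ladder (\<lambda>a b. \<not> \<phi> a b) q A B"
      using Suc.hyps(1)[of p' q] Suc.hyps(2) pq by auto
    obtain h\<^sub>2 where h\<^sub>2: "\<And>A B. littlestone_ge \<phi> h\<^sub>2 A B \<Longrightarrow>
        ladder \<phi> p A B \<or> ladder (\<lambda>a b. \<not> \<phi> a b) q' A B"
      using Suc.hyps(1)[of p q'] Suc.hyps(2) pq by auto
    \<comment> \<open>Each \<open>Suc\<close> reserves one level for the root that enters the new
      rung.\<close>
    have "ladder \<phi> p A B \<or> ladder (\<lambda>a b. \<not> \<phi> a b) q A B"
      if AB: "littlestone_ge \<phi> (Suc h\<^sub>1 + Suc h\<^sub>2) A B" for A B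
    proof -
      obtain a where a: "a \<in> A" using littlestone_ge_nonempty[OF AB] by auto
      have "B = {b\<in>B. \<phi> a b} \<union> {b\<in>B. \<not> \<phi> a b}" by auto
      then consider "littlestone_ge \<phi> (Suc h\<^sub>1) A {b\<in>B. \<phi> a b}"
        | "littlestone_ge \<phi> (Suc h\<^sub>2) A {b\<in>B. \<not> \<phi> a b}"
        using littlestone_ge_Un[of \<phi> "Suc h\<^sub>1" "Suc h\<^sub>2" A "{b\<in>B. \<phi> a b}" "{b\<in>B. \<not> \<phi> a b}"] AB
        by auto
      then show ?thesis
      proof cases
        case 1
        then obtain b where b: "b \<in> B" "\<phi> a b"
          "littlestone_ge \<phi> h\<^sub>1 {a'\<in>A. \<not> \<phi> a' b} {b\<in>B. \<phi> a b}" by auto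
        from h\<^sub>1[OF b(3)] show ?thesis
        proof
          assume "ladder \<phi> p' {a'\<in>A. \<not> \<phi> a' b} {b\<in>B. \<phi> a b}"
          then show ?thesis using a b(1,2) pq by auto
        qed (blast intro: ladder_mono)
      next
        case 2
        then obtain b where b: "b \<in> B" "\<not> \<phi> a b"
          "littlestone_ge \<phi> h\<^sub>2 {a'\<in>A. \<phi> a' b} {b\<in>B. \<not> \<phi> a b}" by auto
        from h\<^sub>2[OF b(3)] show ?thesis
        proof
          assume "ladder (\<lambda>a b. \<not> \<phi> a b) q' {a'\<in>A. \<phi> a' b} {b\<in>B. \<not> \<phi> a b}"
          then show ?thesis using a b(1,2) pq by auto
        qed (blast intro: ladder_mono)
      qed
    qed
    then show ?thesis by blast
  qed auto
qed auto

section \<open>Exponential moments along the branches of a tree\<close>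

text \<open>\<open>g\<close> labels the nodes of a binary tree, a node being the list of turns that
  leads to it, and \<open>es\<close> is a branch. A turn counts positively when the label lies on
  its side of \<open>c\<close>: above for \<open>True\<close>, below for
  \<open>False\<close>.\<close>

definition path_sum :: "real \<Rightarrow> (bool list \<Rightarrow> real) \<Rightarrow> bool list \<Rightarrow> real" where
  "path_sum c g es = (\<Sum>t<length es. (if es ! t then 1 else -1) * (g (take t es) - c))"

lemma path_sum_Nil [simp]: "path_sum c g [] = 0"
  by (simp add: path_sum_def)

lemma path_sum_Cons:
  "path_sum c g (e # es) = (if e then 1 else -1) * (g [] - c) + path_sum c (\<lambda>p. g (e # p)) es"
  by (simp add: path_sum_def sum.lessThan_Suc_shift del: sum.lessThan_Suc)

text \<open>The sum is affine in the labels, and the weights of an average total 1.\<close>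

lemma path_sum_avg:
  assumes "as \<noteq> []"
  shows "path_sum c (\<lambda>p. avg as (g p)) es = avg as (\<lambda>a. path_sum c (\<lambda>p. g p a) es)"
proof -
  have "avg as (g p) - c = avg as (\<lambda>a. g p a - c)" for p
    using assms avg_add[of as "g p" "\<lambda>_. -c"] by (simp add: avg_const)
  then show ?thesis unfolding path_sum_def avg_sum by (simp only: avg_cmult)
qed

text \<open>By Jensen's inequality the average labelling the root may be replaced by a single \<open>b\<close>. It splits
  \<open>A\<close> in two parts, one of which has smaller Littlestone dimension, and Pascal's rule closes the
  induction.\<close>

lemma path_weights_le:
  fixes \<phi> :: "'a \<Rightarrow> 'b \<Rightarrow> bool" and \<tau> :: "bool list \<Rightarrow> 'b list"
  assumes K: "exp (l * (1 - c)) + exp (- (l * (1 - c))) \<le> K" "exp (l * c) + exp (- (l * c)) \<le> K"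
    and "\<not> littlestone_ge \<phi> d A B" "\<And>es. es \<in> I \<Longrightarrow> length es = m \<and> a es \<in> A"
    and "\<And>p. \<tau> p \<noteq> [] \<and> set (\<tau> p) \<subseteq> B"
  shows "(\<Sum>es\<in>I. exp (l * path_sum c (\<lambda>p. avg (\<tau> p) (\<lambda>b. of_bool (\<phi> (a es) b))) es))
           \<le> K ^ m * real (\<Sum>k<d. m choose k)"
  using assms(3-)
proof (induction m arbitrary: I a \<tau> A d)
  case 0
  have "I \<subseteq> {[]}" using 0 by auto
  then consider "I = {}" | "I = {[]}" by auto
  then show ?case
  proof cases
    case 2
    then have "A \<noteq> {}" using 0 by auto
    then obtain d' where "d = Suc d'" using 0 by (cases d) auto
    then have "(\<Sum>k<d. (0::nat) choose k) = 1"
      by (simp add: sum.lessThan_Suc_shift del: sum.lessThan_Suc)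
    then show ?thesis using 2 by simp
  qed (simp add: sum_nonneg)
next
  case (Suc m)
  show ?case
  proof (cases d)
    case 0
    with Suc.prems have "I = {}" by auto
    with 0 show ?thesis by simp
  next
    case (Suc d')
    define J where "J e = {es. e # es \<in> I}" for e
    have "I \<subseteq> {es. set es \<subseteq> UNIV \<and> length es = Suc m}" using Suc.prems by auto
    then have finI: "finite I" by (rule finite_subset) (rule finite_lists_length_eq, simp)
    have finJ: "finite (J e)" for e
      using finite_vimageI[OF finI, of "(#) e"] by (simp add: J_def vimage_def)
    have I: "I = (\<Union>e\<in>UNIV. (#) e ` J e)"
    proof -
      have "\<exists>e es'. es = e # es'" if "es \<in> I" for es using Suc.prems(2)[OF that] by (cases es) auto
      then show ?thesis by (fastforce simp: J_def)
    qed
    have split: "(\<Sum>es\<in>I. f es) = (\<Sum>e\<in>UNIV. \<Sum>es\<in>J e. f (e # es))" for f :: "bool list \<Rightarrow> real"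
      unfolding I by (subst sum.UNION_disjoint) (auto simp: finJ sum.reindex)
    define R where "R e es =
      exp (l * path_sum c (\<lambda>p. avg (\<tau> (e # p)) (\<lambda>b. of_bool (\<phi> (a (e # es)) b))) es)" for e es
    define sg :: "bool \<Rightarrow> real" where "sg e = (if e then 1 else -1)" for e
    \<comment> \<open>The weight of the branch \<open>e # es\<close> once the root carries the
      single label \<open>b\<close>; \<open>R\<close> is the factor from below the root.\<close>
    define w where "w e b es = exp (l * (sg e * (of_bool (\<phi> (a (e # es)) b) - c))) * R e es" for e b es
    have root: "\<tau> [] \<noteq> []" "set (\<tau> []) \<subseteq> B" using Suc.prems(3) by auto
    \<comment> \<open>Jensen is used at the root only; the labels below stay averages and are left
      to the induction.\<close>
    have le: "exp (l * path_sum c (\<lambda>p. avg (\<tau> p) (\<lambda>b. of_bool (\<phi> (a (e # es)) b))) (e # es))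
        \<le> avg (\<tau> []) (\<lambda>b. w e b es)" for e es
    proof -
      let ?f = "\<lambda>b. of_bool (\<phi> (a (e # es)) b) :: real"
      have "l * (sg e * (avg (\<tau> []) ?f - c)) = avg (\<tau> []) (\<lambda>b. l * (sg e * (?f b - c)))"
        using avg_add[of "\<tau> []" ?f "\<lambda>_. -c"] root by (simp add: avg_const avg_cmult)
      then have "exp (l * (sg e * (avg (\<tau> []) ?f - c)))
          \<le> avg (\<tau> []) (\<lambda>b. exp (l * (sg e * (?f b - c))))"
        using exp_avg_le[OF root(1)] by metis
      then have "exp (l * (sg e * (avg (\<tau> []) ?f - c))) * R e es
          \<le> avg (\<tau> []) (\<lambda>b. exp (l * (sg e * (?f b - c)))) * R e es"
        by (rule mult_right_mono) (simp add: R_def)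
      then show ?thesis
        unfolding path_sum_Cons w_def R_def sg_def[symmetric]
        by (simp only: distrib_left exp_add mult.commute[of _ "exp (l * path_sum _ _ _)"] avg_cmult)
    qed
    have main: "(\<Sum>e\<in>UNIV. \<Sum>es\<in>J e. w e b es) \<le> K ^ Suc m * real (\<Sum>k<d. Suc m choose k)"
      if b: "b \<in> B" for b
    proof -
      define A1 where "A1 = {a\<in>A. \<phi> a b}"
      define A0 where "A0 = {a\<in>A. \<not> \<phi> a b}"
      \<comment> \<open>If both halves of \<open>A\<close> had dimension at least \<open>d'\<close>,
        the root \<open>b\<close> would give \<open>A\<close> dimension at least
        \<open>d = Suc d'\<close>. So the bound drops to \<open>d'\<close> on one half and stays
        \<open>d\<close> on the other.\<close>
      obtain d1 d0 where d: "\<not> littlestone_ge \<phi> d1 A1 B" "\<not> littlestone_ge \<phi> d0 A0 B"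
        and d10: "d1 = d' \<and> d0 = d \<or> d1 = d \<and> d0 = d'"
      proof -
        have "\<not> littlestone_ge \<phi> d A1 B" "\<not> littlestone_ge \<phi> d A0 B"
          using Suc.prems(1) littlestone_ge_mono[of \<phi> d _ B A B] by (auto simp: A1_def A0_def)
        moreover have "\<not> littlestone_ge \<phi> d' A1 B \<or> \<not> littlestone_ge \<phi> d' A0 B"
          using Suc.prems(1) b Suc by (auto simp: A1_def A0_def)
        ultimately show thesis using that by blast
      qed
      define S where "S d = K ^ m * real (\<Sum>k<d. m choose k)" for d
      have S: "0 \<le> S d" for d
      proof -
        have "0 \<le> K" using K(2) exp_gt_zero[of "l * c"] exp_gt_zero[of "- (l * c)"] by linarith
        then show ?thesis unfolding S_def by (simp add: sum_nonneg)
      qed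
      \<comment> \<open>Branches are grouped by the truth of \<open>\<phi>\<close> at
        \<open>b\<close>, not by their turn \<open>e\<close>, so that the induction sees
        \<open>A1\<close> or \<open>A0\<close> whichever way the branch turns.\<close>
      have R1: "(\<Sum>es\<in>{es\<in>J e. \<phi> (a (e # es)) b}. R e es) \<le> S d1" for e
        unfolding R_def S_def
        by (rule Suc.IH[OF d(1), where a = "\<lambda>es. a (e # es)" and \<tau> = "\<lambda>p. \<tau> (e # p)"])
          (use Suc.prems(2)[of "e # _"] Suc.prems(3) in \<open>auto simp: J_def A1_def\<close>)
      have R0: "(\<Sum>es\<in>{es\<in>J e. \<not> \<phi> (a (e # es)) b}. R e es) \<le> S d0" for e
        unfolding R_def S_def
        by (rule Suc.IH[OF d(2), where a = "\<lambda>es. a (e # es)" and \<tau> = "\<lambda>p. \<tau> (e # p)"])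
          (use Suc.prems(2)[of "e # _"] Suc.prems(3) in \<open>auto simp: J_def A0_def\<close>)
      have "(\<Sum>es\<in>J e. w e b es) \<le> exp (l * (sg e * (1 - c))) * S d1 + exp (l * (sg e * (0 - c))) * S d0" for e
      proof -
        have "(\<Sum>es\<in>J e. w e b es) = (\<Sum>es\<in>{es\<in>J e. \<phi> (a (e # es)) b}. w e b es)
            + (\<Sum>es\<in>{es\<in>J e. \<not> \<phi> (a (e # es)) b}. w e b es)"
          by (subst sum.union_disjoint[symmetric]) (auto simp: finJ intro!: sum.cong)
        also have "\<dots> = exp (l * (sg e * (1 - c))) * (\<Sum>es\<in>{es\<in>J e. \<phi> (a (e # es)) b}. R e es)
            + exp (l * (sg e * (0 - c))) * (\<Sum>es\<in>{es\<in>J e. \<not> \<phi> (a (e # es)) b}. R e es)"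
          by (simp add: w_def sum_distrib_left)
        also have "\<dots> \<le> exp (l * (sg e * (1 - c))) * S d1 + exp (l * (sg e * (0 - c))) * S d0"
          by (intro add_mono mult_left_mono R1 R0) auto
        finally show ?thesis .
      qed
      then have "(\<Sum>e\<in>UNIV. \<Sum>es\<in>J e. w e b es)
          \<le> (\<Sum>e\<in>UNIV. exp (l * (sg e * (1 - c))) * S d1 + exp (l * (sg e * (0 - c))) * S d0)"
        by (rule sum_mono)
      \<comment> \<open>Adding both turns gives the moment of a symmetric random step, of size
        \<open>1 - c\<close> on one half and \<open>c\<close> on the other.\<close>
      also have "\<dots> = (exp (l * (1 - c)) + exp (- (l * (1 - c)))) * S d1
          + (exp (l * c) + exp (- (l * c))) * S d0"
        by (simp add: UNIV_bool sg_def algebra_simps)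
      also have "\<dots> \<le> K * S d1 + K * S d0"
        by (intro add_mono mult_right_mono K S)
      also have "\<dots> = K ^ Suc m * real (\<Sum>k<d. Suc m choose k)"
      proof -
        have "(\<Sum>k<d. Suc m choose k) = (\<Sum>k<d'. m choose k) + (\<Sum>k<d. m choose k)"
          unfolding Suc sum.lessThan_Suc_shift by (simp add: sum.distrib)
        then show ?thesis using d10 by (auto simp: S_def algebra_simps)
      qed
      finally show ?thesis .
    qed
    have "(\<Sum>es\<in>I. exp (l * path_sum c (\<lambda>p. avg (\<tau> p) (\<lambda>b. of_bool (\<phi> (a es) b))) es))
        \<le> (\<Sum>e\<in>UNIV. \<Sum>es\<in>J e. avg (\<tau> []) (\<lambda>b. w e b es))"
      unfolding split by (intro sum_mono le)
    also have "\<dots> = avg (\<tau> []) (\<lambda>b. \<Sum>e\<in>UNIV. \<Sum>es\<in>J e. w e b es)"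
      by (simp only: avg_sum)
    also have "\<dots> \<le> K ^ Suc m * real (\<Sum>k<d. Suc m choose k)"
      by (rule avg_le) (use root main in auto)
    finally show ?thesis .
  qed
qed

section \<open>Half graphs of averages\<close>

fun bin_val :: "bool list \<Rightarrow> nat" where
  "bin_val [] = 0"
| "bin_val (e # es) = (if e then 2 ^ length es else 0) + bin_val es"

lemma bin_val_less: "bin_val es < 2 ^ length es"
  by (induction es) auto

lemma bin_val_append: "bin_val (p @ q) = bin_val p * 2 ^ length q + bin_val q"
  by (induction p) (auto simp: power_add algebra_simps)

lemma bin_val_replicate_False [simp]: "bin_val (replicate n False) = 0"
  by (induction n) auto

text \<open>The most significant digit comes first, so the branches through a node have consecutive
  values. The node \<open>take t es\<close> continued by \<open>True\<close> and zeros is the least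
  of those that turn \<open>True\<close> there.\<close>

lemma bin_val_search:
  assumes "t < length es"
  shows "bin_val (take t es @ True # replicate (length es - t - 1) False) \<le> bin_val es \<longleftrightarrow> es ! t"
proof -
  define q where "q = drop (Suc t) es"
  have "es = take t es @ es ! t # q" using assms by (simp add: q_def id_take_nth_drop)
  then have "bin_val es = bin_val (take t es) * 2 ^ Suc (length q) + bin_val (es ! t # q)"
    using bin_val_append[of "take t es" "es ! t # q"] by simp
  moreover have "length es - t - 1 = length q" by (simp add: q_def)
  ultimately show ?thesis using bin_val_less[of q] by (simp add: bin_val_append)
qed

section \<open>Estimates for exponentials and binomial sums\<close>

lemma exp_minus_le_quadratic:
  fixes u :: real
  assumes "0 \<le> u" "u \<le> 1"
  shows "exp (- u) \<le> 1 - u + u\<^sup>2"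
proof -
  have "1 \<le> (1 - u + u\<^sup>2) * (1 + u + u\<^sup>2 / 2)"
  proof -
    have "(1 - u + u\<^sup>2) * (1 + u + u\<^sup>2 / 2) = 1 + u\<^sup>2 / 2 + u ^ 3 / 2 + u ^ 4 / 2"
      by (simp add: field_simps power2_eq_square power3_eq_cube power4_eq_xxxx)
    then show ?thesis using assms by simp
  qed
  also have "\<dots> \<le> (1 - u + u\<^sup>2) * exp u"
    by (intro mult_left_mono exp_lower_Taylor_quadratic) (use assms in auto)
  finally show ?thesis by (simp add: exp_minus field_simps)
qed

text \<open>The linear terms of the two quadratic bounds cancel. This controls the exponential
  moment of one random step.\<close>

lemma exp_sum_le_quadratic:
  fixes u :: real
  assumes "\<bar>u\<bar> \<le> 1"
  shows "exp u + exp (- u) \<le> 2 * (1 + u\<^sup>2)"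
proof -
  have "exp \<bar>u\<bar> + exp (- \<bar>u\<bar>) \<le> 2 * (1 + u\<^sup>2)"
    using exp_bound[of "\<bar>u\<bar>"] exp_minus_le_quadratic[of "\<bar>u\<bar>"] assms by simp
  then show ?thesis by (cases "0 \<le> u") auto
qed

text \<open>The binomial sum is at most \<open>d * (m + 1) ^ d\<close>, while
  \<open>(q / p) ^ m\<close> grows exponentially.\<close>

lemma ex_power_beats_polynomial:
  fixes p q :: real
  assumes "0 < p" "p < q"
  shows "\<exists>m::nat. p ^ m * real (\<Sum>k<d. m choose k) < q ^ m"
proof -
  have le: "(\<Sum>k<d. m choose k) \<le> d * (m + 1) ^ d" for m
  proof -
    have "(m choose k) \<le> (m + 1) ^ d" if "k < d" for k
    proof -
      have "(m choose k) \<le> m ^ k" by (cases "k \<le> m") (auto simp: binomial_le_pow binomial_eq_0)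
      also have "\<dots> \<le> (m + 1) ^ k" by (rule power_mono) auto
      also have "\<dots> \<le> (m + 1) ^ d" by (rule power_increasing) (use that in auto)
      finally show ?thesis .
    qed
    then have "(\<Sum>k<d. m choose k) \<le> (\<Sum>k<d. (m + 1) ^ d)" by (intro sum_mono) auto
    then show ?thesis by simp
  qed
  define \<rho> where "\<rho> = q / p"
  have \<rho>: "1 < \<rho>" using assms by (simp add: \<rho>_def)
  define x where "x m = real (Suc m) * ln \<rho>" for m
  have "filterlim x at_top sequentially"
    unfolding x_def
    by (rule filterlim_at_top_mult_tendsto_pos[where c = "ln \<rho>"])
      (use \<rho> filterlim_compose[OF filterlim_real_sequentially filterlim_Suc] in auto)
  then have "((\<lambda>m. x m ^ d / exp (x m)) \<longlongrightarrow> 0) sequentially"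
    by (rule filterlim_compose[OF tendsto_power_div_exp_0])
  \<comment> \<open>Since \<open>exp (x m) = \<rho> * \<rho> ^ m\<close>, falling below this
    threshold means \<open>(m + 1) ^ d * (d + 1) < \<rho> ^ m\<close>. \<open>Suc d\<close> keeps
    the denominator positive when \<open>d = 0\<close>.\<close>
  moreover have "0 < ln \<rho> ^ d / (\<rho> * real (Suc d))" using \<rho> by simp
  ultimately have "eventually (\<lambda>m. x m ^ d / exp (x m) < ln \<rho> ^ d / (\<rho> * real (Suc d))) sequentially"
    by (rule order_tendstoD(2))
  then obtain m where m': "x m ^ d / exp (x m) < ln \<rho> ^ d / (\<rho> * real (Suc d))"
    using eventually_happens'[OF sequentially_bot] by blast
  have "exp (x m) = \<rho> * \<rho> ^ m"
    using \<rho> by (simp only: x_def exp_of_nat_mult) simp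
  with m' have "real (Suc m) ^ d * real (Suc d) < \<rho> ^ m"
    using \<rho> by (simp add: x_def power_mult_distrib field_simps del: of_nat_Suc)
  moreover have "real d * real (Suc m) ^ d \<le> real (Suc m) ^ d * real (Suc d)"
    by (simp add: mult.commute del: of_nat_Suc) 
  ultimately have m: "real d * (real m + 1) ^ d < \<rho> ^ m" by (simp only: of_nat_Suc add.commute)
  have "real (\<Sum>k<d. m choose k) \<le> real d * (real m + 1) ^ d"
    using of_nat_mono[OF le[of m], where 'a = real] by (simp add: add.commute)
  also have "\<dots> < q ^ m / p ^ m" using m by (simp add: \<rho>_def power_divide)
  finally show ?thesis using assms by (intro exI[of _ m]) (simp add: field_simps)
qed

text \<open>Two estimates of one sum of exponentials over \<open>2 ^ m\<close> branches: the half
  graph makes it at least \<open>2 ^ m * exp (l * \<delta>) ^ m\<close>, and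
  \<open>path_weights_le\<close> at most \<open>(2 * p) ^ m\<close> times a polynomial, where
  \<open>p < exp (l * \<delta>)\<close>.\<close>

theorem averages_no_long_half_graph:
  fixes \<phi> :: "'a \<Rightarrow> 'b \<Rightarrow> bool" and r s :: real
  assumes d: "\<not> littlestone_ge \<phi> d A B" and "r < s"
  shows "\<exists>N::nat. \<forall>(as :: nat \<Rightarrow> 'a list) (bs :: nat \<Rightarrow> 'b list).
    (\<forall>i\<in>{1..N}. as i \<noteq> [] \<and> set (as i) \<subseteq> A) \<longrightarrow> (\<forall>j\<in>{1..N}. bs j \<noteq> [] \<and> set (bs j) \<subseteq> B) \<longrightarrow>
    \<not> (\<forall>i\<in>{1..N}. \<forall>j\<in>{1..N}.
         if i < j then avg (as i) (\<lambda>a. avg (bs j) (\<lambda>b. of_bool (\<phi> a b))) \<le> r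
         else avg (as i) (\<lambda>a. avg (bs j) (\<lambda>b. of_bool (\<phi> a b))) \<ge> s)"
proof -
  define c where "c = (r + s) / 2"
  define \<delta> where "\<delta> = (s - r) / 2"
  \<comment> \<open>\<open>\<kappa>\<close> is the largest distance of a truth value 0 or 1 from the
    midpoint \<open>c\<close>. The choice of \<open>l\<close> ensures
    \<open>l * \<kappa> \<le> 1\<close>, for the quadratic bound on \<open>exp\<close>, and a gain
    \<open>l * \<delta>\<close> above the cost \<open>(l * \<kappa>)^2\<close>; the factor 2 makes
    this strict.\<close>
  define \<kappa> where "\<kappa> = max \<bar>c\<bar> \<bar>1 - c\<bar>"
  define l where "l = min (1 / \<kappa>) (\<delta> / (2 * \<kappa>\<^sup>2))"
  have \<delta>: "0 < \<delta>" using assms by (simp add: \<delta>_def)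
  have \<kappa>: "0 < \<kappa>" by (auto simp: \<kappa>_def max_def)
  have l: "0 < l" "l * \<kappa> \<le> 1" "l * \<kappa>\<^sup>2 < \<delta>"
  proof -
    show "0 < l" using \<delta> \<kappa> by (simp add: l_def)
    have "l * \<kappa> \<le> 1 / \<kappa> * \<kappa>" using \<kappa> by (intro mult_right_mono) (auto simp: l_def)
    then show "l * \<kappa> \<le> 1" using \<kappa> by simp
    have "l * \<kappa>\<^sup>2 \<le> \<delta> / (2 * \<kappa>\<^sup>2) * \<kappa>\<^sup>2" using \<kappa> by (intro mult_right_mono) (auto simp: l_def)
    then show "l * \<kappa>\<^sup>2 < \<delta>" using \<kappa> \<delta> by (simp add: field_simps)
  qed
  define p where "p = 1 + (l * \<kappa>)\<^sup>2"
  have K: "exp (l * u) + exp (- (l * u)) \<le> 2 * p" if "\<bar>u\<bar> \<le> \<kappa>" for u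
  proof -
    have "\<bar>l * u\<bar> \<le> l * \<kappa>" using l that by (simp add: abs_mult)
    moreover from this have "(l * u)\<^sup>2 \<le> (l * \<kappa>)\<^sup>2" by (rule power2_le_iff_abs_le[THEN iffD2, rotated]) (use l \<kappa> in simp)
    ultimately show ?thesis using exp_sum_le_quadratic[of "l * u"] l by (simp add: p_def)
  qed
  have p: "0 < p" "p < exp (l * \<delta>)"
  proof -
    show "0 < p" by (simp add: p_def add_pos_nonneg)
    have "(l * \<kappa>)\<^sup>2 < l * \<delta>" using l by (simp add: power2_eq_square mult.assoc mult.left_commute)
    then show "p < exp (l * \<delta>)" using exp_ge_add_one_self[of "l * \<delta>"] unfolding p_def by linarith
  qed
  obtain m where m: "p ^ m * real (\<Sum>k<d. m choose k) < exp (l * \<delta>) ^ m"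
    using ex_power_beats_polynomial[OF p] by blast
  show ?thesis
  proof (intro exI[of _ "2 ^ m"] allI impI notI)
    fix as :: "nat \<Rightarrow> 'a list" and bs :: "nat \<Rightarrow> 'b list"
    assume as: "\<forall>i\<in>{1..2 ^ m}. as i \<noteq> [] \<and> set (as i) \<subseteq> A"
      and bs: "\<forall>j\<in>{1..2 ^ m}. bs j \<noteq> [] \<and> set (bs j) \<subseteq> B"
      and half: "\<forall>i\<in>{1..2 ^ m}. \<forall>j\<in>{1..2 ^ m}.
         if i < j then avg (as i) (\<lambda>a. avg (bs j) (\<lambda>b. of_bool (\<phi> a b))) \<le> r
         else avg (as i) (\<lambda>a. avg (bs j) (\<lambda>b. of_bool (\<phi> a b))) \<ge> s"
    \<comment> \<open>\<open>Suc\<close> moves the values of branches to \<open>{1..2 ^ m}\<close>.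
      A node \<open>t\<close> is labelled by \<open>bs j\<close> for the first branch
      \<open>j\<close> that turns \<open>True\<close> at \<open>t\<close>.\<close>
    define ix where "ix es = Suc (bin_val es)" for es
    define nd where "nd t = t @ True # replicate (m - length t - 1) False" for t
    \<comment> \<open>\<open>bs 1\<close> is a dummy: a branch of length \<open>m\<close> meets only
      nodes of length below \<open>m\<close>.\<close>
    define \<tau> where "\<tau> t = (if length t < m then bs (ix (nd t)) else bs 1)" for t
    define I where "I = {es :: bool list. length es = m}"
    have ix: "ix es \<in> {1..2 ^ m}" if "length es = m" for es
      using bin_val_less[of es] that by (auto simp: ix_def)
    have \<tau>: "\<tau> t \<noteq> [] \<and> set (\<tau> t) \<subseteq> B" for t
    proof (cases "length t < m")
      case True
      then have "ix (nd t) \<in> {1..2 ^ m}" by (intro ix) (simp add: nd_def)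
      then show ?thesis using bs True by (simp add: \<tau>_def)
    qed (use bs in \<open>simp add: \<tau>_def\<close>)
    \<comment> \<open>The average of the path sums over \<open>as (ix es)\<close> is at least
      \<open>m * \<delta>\<close>, so some entry attains this.\<close>
    have "\<exists>a\<in>set (as (ix es)). m * \<delta> \<le> path_sum c (\<lambda>t. avg (\<tau> t) (\<lambda>b. of_bool (\<phi> a b))) es"
      if es: "es \<in> I" for es
    proof (rule ccontr)
      let ?g = "\<lambda>t a. avg (\<tau> t) (\<lambda>b. of_bool (\<phi> a b)) :: real"
      assume "\<not> ?thesis"
      then have small: "path_sum c (\<lambda>t. ?g t a) es < m * \<delta>" if "a \<in> set (as (ix es))" for a
        using that by force
      have len: "length es = m" using es by (simp add: I_def)
      have ne: "as (ix es) \<noteq> []" using as ix[OF len] by blast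
      have "m * \<delta> \<le> path_sum c (\<lambda>t. avg (as (ix es)) (?g t)) es"
      proof -
        \<comment> \<open>At a turn \<open>True\<close> the node's index is at most that of the
          branch, so the value is at least \<open>s\<close>; at a turn \<open>False\<close> it is
          larger and the value is at most \<open>r\<close>.\<close>
        have "\<delta> \<le> (if es ! t then 1 else -1) * (avg (as (ix es)) (?g (take t es)) - c)"
          if t: "t < m" for t
        proof -
          have nd: "length (nd (take t es)) = m" using t len by (simp add: nd_def)
          have "ix (nd (take t es)) \<le> ix es \<longleftrightarrow> es ! t"
            using bin_val_search[of t es] t len by (simp add: ix_def nd_def min_def)
          moreover have "\<tau> (take t es) = bs (ix (nd (take t es)))" using t len by (simp add: \<tau>_def)
          ultimately show ?thesis
            using half[rule_format, OF ix[OF len] ix[OF nd]]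
            by (auto simp: \<delta>_def c_def field_simps split: if_splits)
        qed
        then have "(\<Sum>t<m. \<delta>) \<le> path_sum c (\<lambda>t. avg (as (ix es)) (?g t)) es"
          unfolding path_sum_def len by (intro sum_mono) auto
        then show ?thesis by simp
      qed
      also have "\<dots> = avg (as (ix es)) (\<lambda>a. path_sum c (\<lambda>t. ?g t a) es)"
        by (rule path_sum_avg[OF ne])
      also have "\<dots> < m * \<delta>"
      proof -
        have "(\<Sum>a\<leftarrow>as (ix es). path_sum c (\<lambda>t. ?g t a) es) < (\<Sum>a\<leftarrow>as (ix es). m * \<delta>)"
          using small ne by (intro sum_list_strict_mono) auto
        then show ?thesis using ne by (simp add: avg_def sum_list_triv field_simps)
      qed
      finally show False by simp
    qed
    then obtain a where a: "\<And>es. es \<in> I \<Longrightarrow> a es \<in> set (as (ix es))"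
      "\<And>es. es \<in> I \<Longrightarrow> m * \<delta> \<le> path_sum c (\<lambda>t. avg (\<tau> t) (\<lambda>b. of_bool (\<phi> (a es) b))) es"
      by metis
    have card: "card I = 2 ^ m"
      using card_lists_length_eq[of "UNIV :: bool set" m] by (simp add: I_def)
    have "2 ^ m * exp (l * \<delta>) ^ m = (\<Sum>es\<in>I. exp (l * (m * \<delta>)))"
      by (simp add: card exp_of_nat_mult[symmetric] algebra_simps)
    also have "\<dots> \<le> (\<Sum>es\<in>I. exp (l * path_sum c (\<lambda>t. avg (\<tau> t) (\<lambda>b. of_bool (\<phi> (a es) b))) es))"
      using a(2) l(1) by (intro sum_mono) simp
    also have "\<dots> \<le> (2 * p) ^ m * real (\<Sum>k<d. m choose k)"
    proof (rule path_weights_le[OF _ _ d])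
      show "length es = m \<and> a es \<in> A" if "es \<in> I" for es
        using a(1)[OF that] as ix[of es] that by (auto simp: I_def)
    qed (use K[of c] K[of "1 - c"] \<tau> in \<open>auto simp: \<kappa>_def\<close>)
    also have "\<dots> = 2 ^ m * (p ^ m * real (\<Sum>k<d. m choose k))" by (simp add: power_mult_distrib)
    also have "\<dots> < 2 ^ m * exp (l * \<delta>) ^ m" using m by simp
    finally show False by simp
  qed
qed

section \<open>Ultrapowers\<close>

lemma eval_cong: "(\<And>n. n \<in> fv_tm t \<Longrightarrow> v n = w n) \<Longrightarrow> eval M v t = eval M w t"
proof (induction t)
  case (Fun f ts)
  then have "map (eval M v) ts = map (eval M w) ts" by auto
  then show ?case by (simp only: eval.simps)
qed auto

lemma sat_cong: "(\<And>n. n \<in> fv \<psi> \<Longrightarrow> v n = w n) \<Longrightarrow> sat M v \<psi> \<longleftrightarrow> sat M w \<psi>"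
proof (induction \<psi> arbitrary: v w)
  case (Eq t u)
  then have "eval M v t = eval M w t" "eval M v u = eval M w u" by (auto intro: eval_cong)
  then show ?case by simp
next
  case (Rel R ts)
  then have "map (eval M v) ts = map (eval M w) ts" by (auto intro: eval_cong)
  then show ?case by (simp only: sat.simps)
next
  case (Neg \<psi>)
  then show ?case by (metis fv.simps(3) sat.simps(3))
next
  case (Conj \<psi>1 \<psi>2)
  have "sat M v \<psi>1 = sat M w \<psi>1" by (rule Conj.IH) (use Conj.prems in auto)
  moreover have "sat M v \<psi>2 = sat M w \<psi>2" by (rule Conj.IH) (use Conj.prems in auto)
  ultimately show ?case by simp
next
  case (Exists n \<psi>)
  have "sat M (v(n := a)) \<psi> = sat M (w(n := a)) \<psi>" for a
    by (rule Exists.IH) (use Exists.prems in auto)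
  then show ?case by simp
qed

lemma finite_fv_tm: "finite (fv_tm t)"
  by (induction t) auto

lemma finite_fv: "finite (fv \<psi>)"
  by (induction \<psi>) (auto simp: finite_fv_tm)

text \<open>Stated on \<open>xs\<close> only: elsewhere \<open>assign\<close> is
  \<open>undefined\<close>, which \<open>f\<close> need not preserve.\<close>

lemma assign_map:
  assumes "length z = length xs" "n \<in> set xs"
  shows "assign xs (map f z) n = f (assign xs z n)"
proof -
  obtain u where "map_of (zip xs z) n = Some u" using assms by (metis map_of_zip_is_Some)
  then show ?thesis by (simp add: assign_def zip_map2 map_of_map)
qed

lemma assign_in_set:
  assumes "length z = length xs" "n \<in> set xs"
  shows "assign xs z n \<in> set z"
proof -
  obtain u where "map_of (zip xs z) n = Some u" using assms by (metis map_of_zip_is_Some)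
  then show ?thesis using assms by (auto simp: assign_def dest!: map_of_SomeD set_zip_rightD)
qed

section \<open>Ultrafilters\<close>

definition ultrafilter :: "'i filter \<Rightarrow> bool" where
  "ultrafilter U \<longleftrightarrow> U \<noteq> bot \<and> (\<forall>P. eventually P U \<or> eventually (\<lambda>i. \<not> P i) U)"

lemma ultrafilter_not: "ultrafilter U \<Longrightarrow> eventually (\<lambda>i. \<not> P i) U \<longleftrightarrow> \<not> eventually P U"
  unfolding ultrafilter_def using eventually_elim2[of P U "\<lambda>i. \<not> P i" "\<lambda>_. False"]
  by (metis eventually_False)

text \<open>Zorn's lemma on the proper filters below \<open>F\<close>, with the order reversed since
  finer filters are smaller. A minimal one decides every \<open>P\<close>: adjoining
  \<open>P\<close> keeps it proper unless \<open>P\<close> eventually fails.\<close>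

lemma ex_ultrafilter_le:
  fixes F :: "'i filter"
  assumes "F \<noteq> bot"
  shows "\<exists>U\<le>F. ultrafilter U"
proof -
  define \<F> where "\<F> = {G. G \<noteq> bot \<and> G \<le> F}"
  have "\<exists>U\<in>\<F>. \<forall>G\<in>\<F>. U \<ge> G \<longrightarrow> G = U"
  proof (rule predicate_Zorn)
    show "partial_order_on \<F> (relation_of (\<ge>) \<F>)"
      by (rule partial_order_on_relation_ofI) auto
    fix C assume "C \<in> Chains (relation_of (\<ge>) \<F>)"
    then have C: "C \<subseteq> \<F>" "\<And>G H. G \<in> C \<Longrightarrow> H \<in> C \<Longrightarrow> G \<le> H \<or> H \<le> G"
      by (auto simp: Chains_def relation_of_def)
    show "\<exists>U\<in>\<F>. \<forall>G\<in>C. U \<le> G"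
    proof (cases "C = {}")
      case True
      then show ?thesis using assms by (auto simp: \<F>_def)
    next
      case False
      \<comment> \<open>A chain is directed, so what is eventual in its infimum is eventual in a
        member; hence the infimum is proper.\<close>
      have "\<exists>x\<in>C. x \<le> inf G H" if "G \<in> C" "H \<in> C" for G H
        using C(2)[OF that] that by auto
      then have "eventually (\<lambda>_. False) (Inf C) \<longleftrightarrow> (\<exists>G\<in>C. eventually (\<lambda>_. False) G)"
        by (rule eventually_Inf_base[OF False])
      then have "Inf C \<noteq> bot" using C(1) by (auto simp: \<F>_def eventually_False)
      moreover have "Inf C \<le> F" using False C(1) by (auto simp: \<F>_def intro: Inf_lower2)
      ultimately show ?thesis by (auto simp: \<F>_def intro: Inf_lower)
    qed
  qed
  then obtain U where U: "U \<noteq> bot" "U \<le> F" "\<And>G. G \<noteq> bot \<Longrightarrow> G \<le> U \<Longrightarrow> G = U"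
    by (auto simp: \<F>_def)
  have "eventually P U" if "\<not> eventually (\<lambda>i. \<not> P i) U" for P
  proof -
    let ?G = "inf U (principal {i. P i})"
    have "?G \<noteq> bot" using that by (auto simp: trivial_limit_def eventually_inf_principal)
    then have "?G = U" by (rule U) simp
    moreover have "eventually P ?G" by (simp add: eventually_inf_principal)
    ultimately show ?thesis by simp
  qed
  then show ?thesis using U by (auto simp: ultrafilter_def)
qed

text \<open>The elements of the ultrapower are chosen representatives \<open>canon U f\<close> of the classes modulo
  \<open>U\<close>, so that equality is interpreted by equality.\<close>

definition canon :: "'i filter \<Rightarrow> ('i \<Rightarrow> 'a) \<Rightarrow> 'i \<Rightarrow> 'a" where
  "canon U f = (SOME g. \<forall>\<^sub>F i in U. g i = f i)"

lemma eventually_canon: "\<forall>\<^sub>F i in U. canon U f i = f i"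
  unfolding canon_def by (rule someI[of "\<lambda>g. \<forall>\<^sub>F i in U. g i = f i" f]) simp

lemma canon_eq_iff: "canon U f = canon U g \<longleftrightarrow> (\<forall>\<^sub>F i in U. f i = g i)"
proof
  assume "canon U f = canon U g"
  then show "\<forall>\<^sub>F i in U. f i = g i"
    using eventually_elim2[OF eventually_canon[of U f] eventually_canon[of U g]] by simp
next
  assume *: "\<forall>\<^sub>F i in U. f i = g i"
  have "(\<forall>\<^sub>F i in U. h i = f i) \<longleftrightarrow> (\<forall>\<^sub>F i in U. h i = g i)" for h
    by (rule eventually_subst) (use * in eventually_elim, simp)
  then show "canon U f = canon U g" by (simp add: canon_def)
qed

lemma canon_canon [simp]: "canon U (canon U f) = canon U f"
  by (simp add: canon_eq_iff eventually_canon)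

text \<open>Membership in \<open>dom_of M\<close> is asked only eventually, as \<open>canon\<close>
  may choose a representative that leaves it on a null set.\<close>

definition ultrapower :: "'i filter \<Rightarrow> ('a, 'f, 'r) struct \<Rightarrow> ('i \<Rightarrow> 'a, 'f, 'r) struct" where
  "ultrapower U M =
    \<lparr>dom_of = {f. canon U f = f \<and> (\<forall>\<^sub>F i in U. f i \<in> dom_of M)},
     fun_of = \<lambda>f as. canon U (\<lambda>i. fun_of M f (map (\<lambda>a. a i) as)),
     rel_of = \<lambda>R as. \<forall>\<^sub>F i in U. rel_of M R (map (\<lambda>a. a i) as)\<rparr>"

lemma canon_in_ultrapower:
  assumes "\<forall>\<^sub>F i in U. f i \<in> dom_of M"
  shows "canon U f \<in> dom_of (ultrapower U M)"
  using eventually_elim2[OF assms eventually_canon[of U f], of "\<lambda>i. canon U f i \<in> dom_of M"]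
  by (simp add: ultrapower_def)

lemma is_struct_ultrapower:
  assumes "is_struct L M"
  shows "is_struct L (ultrapower U M)"
  unfolding is_struct_def
proof (intro conjI allI impI)
  obtain a where "a \<in> dom_of M" using assms by (auto simp: is_struct_def)
  then show "dom_of (ultrapower U M) \<noteq> {}" using canon_in_ultrapower[of "\<lambda>_. a" M U] by auto
next
  fix f as
  assume as: "fun_arity L f = Some (length as) \<and> set as \<subseteq> dom_of (ultrapower U M)"
  then have "\<forall>\<^sub>F i in U. \<forall>a\<in>set as. a i \<in> dom_of M"
    by (intro eventually_ball_finite) (auto simp: ultrapower_def)
  then have "\<forall>\<^sub>F i in U. fun_of M f (map (\<lambda>a. a i) as) \<in> dom_of M"
  proof eventually_elim
    case (elim i)
    then have "set (map (\<lambda>a. a i) as) \<subseteq> dom_of M" by auto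
    then show ?case using assms as unfolding is_struct_def by (metis length_map)
  qed
  from canon_in_ultrapower[OF this] show "fun_of (ultrapower U M) f as \<in> dom_of (ultrapower U M)"
    by (simp add: ultrapower_def)
qed

lemma eval_ultrapower:
  "(\<And>n. n \<in> fv_tm t \<Longrightarrow> canon U (v n) = v n) \<Longrightarrow>
     eval (ultrapower U M) v t = canon U (\<lambda>i. eval M (\<lambda>n. v n i) t)"
proof (induction t)
  case (Fun f ts)
  have "\<forall>\<^sub>F i in U. eval (ultrapower U M) v t i = eval M (\<lambda>n. v n i) t" if "t \<in> set ts" for t
  proof -
    have "eval (ultrapower U M) v t = canon U (\<lambda>i. eval M (\<lambda>n. v n i) t)"
      by (rule Fun.IH[OF that]) (use Fun.prems that in auto)
    then show ?thesis by (simp add: eventually_canon)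
  qed
  then have "\<forall>\<^sub>F i in U. \<forall>t\<in>set ts. eval (ultrapower U M) v t i = eval M (\<lambda>n. v n i) t"
    by (intro eventually_ball_finite) auto
  then have "\<forall>\<^sub>F i in U. fun_of M f (map (\<lambda>a. a i) (map (eval (ultrapower U M) v) ts))
      = eval M (\<lambda>n. v n i) (Fun f ts)"
  proof eventually_elim
    case (elim i)
    then have "map (\<lambda>a. a i) (map (eval (ultrapower U M) v) ts) = map (eval M (\<lambda>n. v n i)) ts"
      by auto
    then show ?case by (simp only: eval.simps)
  qed
  then show ?case by (simp add: ultrapower_def canon_eq_iff)
qed simp

text \<open>The theorem of Los. Negation uses that \<open>U\<close> decides every property; the
  quantifier picks a witness in each coordinate. Only free variables are constrained, since
  \<open>assign\<close> is \<open>undefined\<close> off its variables.\<close>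

theorem los:
  assumes U: "ultrafilter U"
  shows "(\<And>n. n \<in> fv \<psi> \<Longrightarrow> v n \<in> dom_of (ultrapower U M)) \<Longrightarrow>
    sat (ultrapower U M) v \<psi> \<longleftrightarrow> (\<forall>\<^sub>F i in U. sat M (\<lambda>n. v n i) \<psi>)"
proof (induction \<psi> arbitrary: v)
  case (Eq t u)
  have c: "canon U (v n) = v n" if "n \<in> fv_tm t \<union> fv_tm u" for n
    using Eq[of n] that by (auto simp: ultrapower_def)
  then show ?case by (simp add: eval_ultrapower canon_eq_iff)
next
  case (Rel R ts)
  have c: "canon U (v n) = v n" if "t \<in> set ts" "n \<in> fv_tm t" for t n
    using Rel[of n] that by (auto simp: ultrapower_def)
  have "\<forall>\<^sub>F i in U. eval (ultrapower U M) v t i = eval M (\<lambda>n. v n i) t" if "t \<in> set ts" for t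
    using c[OF that] by (simp add: eval_ultrapower eventually_canon)
  then have "\<forall>\<^sub>F i in U. \<forall>t\<in>set ts. eval (ultrapower U M) v t i = eval M (\<lambda>n. v n i) t"
    by (intro eventually_ball_finite) auto
  then have "\<forall>\<^sub>F i in U. rel_of M R (map (\<lambda>a. a i) (map (eval (ultrapower U M) v) ts))
      \<longleftrightarrow> sat M (\<lambda>n. v n i) (Rel R ts)"
  proof eventually_elim
    case (elim i)
    then have "map (\<lambda>a. a i) (map (eval (ultrapower U M) v) ts) = map (eval M (\<lambda>n. v n i)) ts"
      by auto
    then show ?case by (simp only: sat.simps)
  qed
  from eventually_subst[OF this] show ?case by (simp add: ultrapower_def)
next
  case (Neg \<psi>)
  then show ?case by (simp add: ultrafilter_not[OF U])
next
  case (Conj \<psi>1 \<psi>2)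
  then show ?case by (simp add: eventually_conj_iff)
next
  case (Exists n \<psi>)
  have upd: "(\<lambda>k. (v(n := f)) k i) = (\<lambda>k. v k i)(n := f i)" for f i
    by auto
  have IH: "sat (ultrapower U M) (v(n := f)) \<psi>
      \<longleftrightarrow> (\<forall>\<^sub>F i in U. sat M ((\<lambda>k. v k i)(n := f i)) \<psi>)" if "f \<in> dom_of (ultrapower U M)" for f
  proof -
    have "(v(n := f)) k \<in> dom_of (ultrapower U M)" if "k \<in> fv \<psi>" for k
      using Exists.prems[of k] that \<open>f \<in> dom_of (ultrapower U M)\<close> by auto
    from Exists.IH[OF this] show ?thesis by (simp only: upd)
  qed
  show ?case
  proof
    assume "sat (ultrapower U M) v (Exists n \<psi>)"
    then obtain f where f: "f \<in> dom_of (ultrapower U M)"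
      "\<forall>\<^sub>F i in U. sat M ((\<lambda>k. v k i)(n := f i)) \<psi>" using IH by auto
    from f(1) have "\<forall>\<^sub>F i in U. f i \<in> dom_of M" by (simp add: ultrapower_def)
    with f(2) show "\<forall>\<^sub>F i in U. sat M (\<lambda>n. v n i) (Exists n \<psi>)"
      by eventually_elim auto
  next
    assume *: "\<forall>\<^sub>F i in U. sat M (\<lambda>n. v n i) (Exists n \<psi>)"
    define g where "g i = (SOME a. a \<in> dom_of M \<and> sat M ((\<lambda>k. v k i)(n := a)) \<psi>)" for i
    have g: "\<forall>\<^sub>F i in U. g i \<in> dom_of M \<and> sat M ((\<lambda>k. v k i)(n := g i)) \<psi>"
      using *
    proof eventually_elim
      case (elim i)
      then have "\<exists>a. a \<in> dom_of M \<and> sat M ((\<lambda>k. v k i)(n := a)) \<psi>" by auto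
      from someI_ex[OF this] show ?case by (simp add: g_def)
    qed
    have "\<forall>\<^sub>F i in U. g i \<in> dom_of M" using g by eventually_elim simp
    then have dom: "canon U g \<in> dom_of (ultrapower U M)" by (rule canon_in_ultrapower)
    have "\<forall>\<^sub>F i in U. sat M ((\<lambda>k. v k i)(n := canon U g i)) \<psi>"
      using g eventually_canon[of U g] by eventually_elim simp
    then show "sat (ultrapower U M) v (Exists n \<psi>)" using IH[OF dom] dom by auto
  qed
qed

section \<open>Small elementary submodels\<close>

definition skolem :: "('a, 'f, 'r) struct \<Rightarrow> 'a \<Rightarrow> nat \<Rightarrow> ('f, 'r) fm \<Rightarrow> (nat \<Rightarrow> 'a) \<Rightarrow> 'a" where
  "skolem M d n \<psi> v = (if \<exists>a\<in>dom_of M. sat M (v(n := a)) \<psi>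
     then SOME a. a \<in> dom_of M \<and> sat M (v(n := a)) \<psi> else d)"

lemma skolem_in_dom: "d \<in> dom_of M \<Longrightarrow> skolem M d n \<psi> v \<in> dom_of M"
  using someI_ex[of "\<lambda>a. a \<in> dom_of M \<and> sat M (v(n := a)) \<psi>"] by (auto simp: skolem_def)

lemma sat_skolem:
  assumes "sat M v (Exists n \<psi>)"
  shows "sat M (v(n := skolem M d n \<psi> v)) \<psi>"
proof -
  have "\<exists>a. a \<in> dom_of M \<and> sat M (v(n := a)) \<psi>" using assms by auto
  from someI_ex[OF this] assms show ?thesis by (auto simp: skolem_def)
qed

text \<open>Formulas serve as names for the elements of a Skolem hull of the sequence \<open>c\<close>: the formula \<open>p\<close>
  codes the assignment \<open>decode M c p\<close>, and names its value at \<open>0\<close>.\<close>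

fun decode :: "('a, 'f, 'r) struct \<Rightarrow> (nat \<Rightarrow> 'a) \<Rightarrow> ('f, 'r) fm \<Rightarrow> nat \<Rightarrow> 'a" where
  "decode M c (Eq (Var k) t) = (\<lambda>_. c k)"
| "decode M c (Conj p q) = case_nat (decode M c p 0) (decode M c q)"
| "decode M c (Exists n (Conj \<psi> p)) = (\<lambda>_. skolem M (c 0) n \<psi> (decode M c p))"
| "decode M c _ = (\<lambda>_. c 0)"

lemma decode_in_dom:
  assumes "range c \<subseteq> dom_of M"
  shows "decode M c p n \<in> dom_of M"
  using assms
  by (induction M c p arbitrary: n rule: decode.induct) (auto split: nat.split intro!: skolem_in_dom)

text \<open>\<open>Conj\<close> acts as a cons on assignments. Prescribing finitely many values is
  enough for the finitely many free variables of a formula.\<close>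

lemma ex_decode_finite:
  assumes "\<And>n. w n \<in> range (\<lambda>p. decode M c p 0)"
  shows "\<exists>p. \<forall>n<m. decode M c p n = w n"
  using assms
proof (induction m arbitrary: w)
  case (Suc m)
  obtain q where q: "\<forall>n<m. decode M c q n = w (Suc n)"
    using Suc.IH[of "\<lambda>n. w (Suc n)"] Suc.prems by blast
  obtain p where p: "w 0 = decode M c p 0" using Suc.prems by blast
  show ?case
    by (rule exI[of _ "Conj p q"]) (use p q in \<open>auto split: nat.split\<close>)
qed simp

text \<open>The Tarski-Vaught condition for the hull: if \<open>p\<close> codes the parameters, then
  \<open>Exists n (Conj \<psi> p)\<close> names a Skolem witness.\<close>

lemma decode_witness:
  assumes "\<And>k. k \<in> fv \<psi> - {n} \<Longrightarrow> v k \<in> range (\<lambda>p. decode M c p 0)"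
    and "sat M v (Exists n \<psi>)"
  shows "\<exists>a\<in>range (\<lambda>p. decode M c p 0). sat M (v(n := a)) \<psi>"
proof -
  \<comment> \<open>Values off the free variables are reset to \<open>c 0\<close>, which has a
    name.\<close>
  define w where "w k = (if k \<in> fv \<psi> - {n} then v k else c 0)" for k
  have "c 0 = decode M c (Eq (Var 0) (Var 0)) 0" by simp
  then have w: "w k \<in> range (\<lambda>p. decode M c p 0)" for k
    using assms(1) unfolding w_def by (metis rangeI)
  obtain m where m: "\<forall>k\<in>fv \<psi>. k < m" using finite_fv finite_nat_set_iff_bounded by blast
  obtain p where p: "\<forall>k<m. decode M c p k = w k" using ex_decode_finite[of w, OF w] by blast
  have agree: "decode M c p k = v k" if "k \<in> fv \<psi> - {n}" for k
    using that m p by (auto simp: w_def)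
  define a where "a = skolem M (c 0) n \<psi> (decode M c p)"
  have "sat M (decode M c p) (Exists n \<psi>)"
    using assms(2) sat_cong[of "Exists n \<psi>" "decode M c p" v M] agree by simp
  then have "sat M ((decode M c p)(n := a)) \<psi>" unfolding a_def by (rule sat_skolem)
  then have "sat M (v(n := a)) \<psi>"
    using sat_cong[of \<psi> "(decode M c p)(n := a)" "v(n := a)" M] agree by simp
  moreover have "a = decode M c (Exists n (Conj \<psi> p)) 0" by (simp add: a_def)
  ultimately show ?thesis by blast
qed

text \<open>The hull \<open>H\<close> satisfies the Tarski-Vaught test; its elements are replaced by
  formulas that name them, which moves the submodel to the type of formulas.\<close>

theorem downward_loewenheim_skolem:
  fixes L :: "('f, 'r) language" and M :: "('a, 'f, 'r) struct" and c :: "nat \<Rightarrow> 'a"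
  assumes M: "is_struct L M" and c: "range c \<subseteq> dom_of M"
  obtains S :: "('f, 'r) small_struct" and h where
    "is_struct L S" "h ` dom_of S \<subseteq> dom_of M" "range c \<subseteq> h ` dom_of S"
    "\<And>\<psi> v. wf_fm L \<psi> \<Longrightarrow> (\<And>n. n \<in> fv \<psi> \<Longrightarrow> v n \<in> dom_of S) \<Longrightarrow>
       sat S v \<psi> \<longleftrightarrow> sat M (\<lambda>n. h (v n)) \<psi>"
proof -
  define h where "h p = decode M c p 0" for p
  define H where "H = range h"
  \<comment> \<open>One name per element, so that \<open>h\<close> is injective on
    \<open>dom_of S\<close> and equality is preserved.\<close>
  define g where "g = inv_into UNIV h"
  define S :: "('f, 'r) small_struct" where
    "S = \<lparr>dom_of = g ` H, fun_of = \<lambda>f as. g (fun_of M f (map h as)),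
          rel_of = \<lambda>R as. rel_of M R (map h as)\<rparr>"
  have S_sel: "dom_of S = g ` H" "fun_of S f as = g (fun_of M f (map h as))"
    "rel_of S R as = rel_of M R (map h as)" for f R as
    by (simp_all add: S_def)
  have hg: "h (g a) = a" if "a \<in> H" for a
    using that by (simp add: g_def H_def f_inv_into_f)
  have hS: "h p \<in> H" for p by (simp add: H_def)
  have H: "H \<subseteq> dom_of M" using decode_in_dom[OF c] by (auto simp: H_def h_def)
  have inj: "h p = h q \<longleftrightarrow> p = q" if "p \<in> dom_of S" "q \<in> dom_of S" for p q
    using that hg by (auto simp: S_sel)
  have cH: "c k \<in> H" for k
  proof -
    have "c k = h (Eq (Var k) (Var 0))" by (simp add: h_def)
    then show ?thesis by (simp add: H_def)
  qed
  have wit: "\<exists>a\<in>H. sat M (v(n := a)) \<psi>"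
    if "\<And>k. k \<in> fv \<psi> - {n} \<Longrightarrow> v k \<in> H" "sat M v (Exists n \<psi>)" for v n \<psi>
    using decode_witness[of \<psi> n v M c] that by (simp add: H_def h_def)
  \<comment> \<open>The value of \<open>f\<close> is the only witness for \<open>m\<close> in the
    equation \<open>\<psi>\<close>, so it lies in \<open>H\<close>.\<close>
  have clos: "fun_of M f as \<in> H" if f: "fun_arity L f = Some (length as)" and as: "set as \<subseteq> H" for f as
  proof -
    define m where "m = length as"
    define \<psi> :: "('f, 'r) fm" where "\<psi> = Eq (Var m) (Fun f (map Var [0..<m]))"
    define v where "v k = (if k < m then as ! k else c 0)" for k
    have ev: "map (eval M (v(m := a)) \<circ> Var) [0..<m] = as" for a
      by (rule nth_equalityI) (auto simp: v_def m_def)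
    have "fun_of M f as \<in> dom_of M" using M f as H by (auto simp: is_struct_def)
    then have "sat M v (Exists m \<psi>)" using ev by (auto simp: \<psi>_def)
    moreover have "v k \<in> H" for k using as cH by (auto simp: v_def m_def)
    ultimately obtain a where "a \<in> H" "sat M (v(m := a)) \<psi>" using wit by blast
    then show ?thesis using ev[of a] by (simp add: \<psi>_def)
  qed
  have ev: "eval S v t \<in> dom_of S \<and> h (eval S v t) = eval M (\<lambda>n. h (v n)) t"
    if "wf_tm L t" "\<And>n. n \<in> fv_tm t \<Longrightarrow> v n \<in> dom_of S" for v t
    using that
  proof (induction t)
    case (Fun f ts)
    have IH: "h (eval S v t) = eval M (\<lambda>n. h (v n)) t" if "t \<in> set ts" for t
      using Fun.IH[OF that] Fun.prems that by auto
    have "map h (map (eval S v) ts) = map (eval M (\<lambda>n. h (v n))) ts" using IH by auto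
    then have *: "eval S v (Fun f ts) = g (eval M (\<lambda>n. h (v n)) (Fun f ts))"
      by (simp only: eval.simps S_sel)
    have "fun_of M f (map (eval M (\<lambda>n. h (v n))) ts) \<in> H"
      by (rule clos) (use Fun.prems IH[symmetric] hS in auto)
    then show ?case unfolding * by (simp add: hg S_sel)
  qed simp
  have sat: "sat S v \<psi> \<longleftrightarrow> sat M (\<lambda>n. h (v n)) \<psi>"
    if "wf_fm L \<psi>" "\<And>n. n \<in> fv \<psi> \<Longrightarrow> v n \<in> dom_of S" for \<psi> v
    using that
  proof (induction \<psi> arbitrary: v)
    case (Eq t u)
    then have "eval S v t \<in> dom_of S \<and> h (eval S v t) = eval M (\<lambda>n. h (v n)) t"
      "eval S v u \<in> dom_of S \<and> h (eval S v u) = eval M (\<lambda>n. h (v n)) u"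
      by (simp_all add: ev)
    then show ?case using inj[of "eval S v t" "eval S v u"] by simp
  next
    case (Rel R ts)
    have "map h (map (eval S v) ts) = map (eval M (\<lambda>n. h (v n))) ts"
      using Rel ev by (auto intro!: conjunct2[OF ev])
    then show ?case by (simp only: sat.simps S_sel)
  next
    case (Exists n \<psi>)
    have upd: "(\<lambda>k. h ((v(n := p)) k)) = (\<lambda>k. h (v k))(n := h p)" for p by auto
    have IH: "sat S (v(n := p)) \<psi> \<longleftrightarrow> sat M ((\<lambda>k. h (v k))(n := h p)) \<psi>" if "p \<in> dom_of S" for p
    proof -
      have "(v(n := p)) k \<in> dom_of S" if "k \<in> fv \<psi>" for k
        using Exists.prems(2)[of k] that \<open>p \<in> dom_of S\<close> by auto
      from Exists.IH[OF _ this] Exists.prems(1) show ?thesis by (simp only: upd wf_fm.simps)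
    qed
    show ?case
    proof
      assume "sat S v (Exists n \<psi>)"
      then show "sat M (\<lambda>k. h (v k)) (Exists n \<psi>)" using IH H hS by auto
    next
      assume "sat M (\<lambda>k. h (v k)) (Exists n \<psi>)"
      then obtain a where a: "a \<in> H" "sat M ((\<lambda>k. h (v k))(n := a)) \<psi>"
        using wit[of \<psi> n "\<lambda>k. h (v k)"] hS by blast
      then have "g a \<in> dom_of S" "h (g a) = a" by (auto simp: S_sel hg)
      then show "sat S v (Exists n \<psi>)" using IH[of "g a"] a by auto
    qed
  qed auto
  show thesis
  proof (rule that[of S h])
    show "is_struct L S"
      unfolding is_struct_def
    proof (intro conjI allI impI)
      show "dom_of S \<noteq> {}" by (simp add: S_sel H_def)
      fix f as assume "fun_arity L f = Some (length as) \<and> set as \<subseteq> dom_of S"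
      then have "fun_of M f (map h as) \<in> H" by (intro clos) (auto simp: hS)
      then show "fun_of S f as \<in> dom_of S" by (simp add: S_sel)
    qed
    show "h ` dom_of S \<subseteq> dom_of M" using H hS by auto
    show "range c \<subseteq> h ` dom_of S"
    proof
      fix a assume "a \<in> range c"
      then have "a \<in> H" using cH by auto
      then show "a \<in> h ` dom_of S" using hg[of a] unfolding S_sel by (metis imageI)
    qed
  qed (use sat in auto)
qed

section \<open>Stable theories\<close>

text \<open>An ultrapower glues the finite half graphs into an infinite one. It lives on functions,
  so a Skolem hull carries the order property to a structure on formulas, where
  \<open>stable_theory\<close> applies.\<close>

theorem half_graphs_imp_order_property:
  fixes L :: "('f, 'r) language" and M :: "('a, 'f, 'r) struct"
  assumes T: "\<And>\<sigma>. \<sigma> \<in> T \<Longrightarrow> sentence L \<sigma>" and M: "model_of L T M" and \<phi>: "split_fm L \<phi> x y"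
    and half: "\<And>n::nat. \<exists>a b. (\<forall>i<n. a i \<in> tuples M x \<and> b i \<in> tuples M y) \<and>
      (\<forall>i<n. \<forall>j<n. holds M \<phi> x (a i) y (b j) \<longleftrightarrow> i < j)"
  shows "\<exists>S :: ('f, 'r) small_struct. model_of L T S \<and> order_property S \<phi> x y"
proof -
  define Q where "Q n a b \<longleftrightarrow> (\<forall>i<n. a i \<in> tuples M x \<and> b i \<in> tuples M y) \<and>
      (\<forall>i<n. \<forall>j<n. holds M \<phi> x (a i) y (b j) \<longleftrightarrow> i < j)" for n :: nat and a b
  obtain a b where "\<And>n. Q n (a n) (b n)"
    using half unfolding Q_def[symmetric] by metis
  then have ab: "\<And>n i. i < n \<Longrightarrow> a n i \<in> tuples M x"
      "\<And>n i. i < n \<Longrightarrow> b n i \<in> tuples M y"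
      "\<And>n i j. i < n \<Longrightarrow> j < n \<Longrightarrow> holds M \<phi> x (a n i) y (b n j) \<longleftrightarrow> i < j"
    by (simp_all add: Q_def)
  \<comment> \<open>Below \<open>sequentially\<close>, so that a fixed \<open>i\<close> is less than
    almost every \<open>n\<close>.\<close>
  obtain U :: "nat filter" where U: "U \<le> sequentially" "ultrafilter U"
    using ex_ultrafilter_le[OF sequentially_bot] by auto
  have gt: "\<forall>\<^sub>F n in U. i < n" for i :: nat
    using filter_leD[OF U(1) eventually_gt_at_top[of i]] .
  define N where "N = ultrapower U M"
  \<comment> \<open>The \<open>i\<close>-th tuple of the ultrapower has in coordinate
    \<open>n\<close> the \<open>i\<close>-th tuple of the \<open>n\<close>-th half graph; the values
    for \<open>n \<le> i\<close> are irrelevant modulo \<open>U\<close>.\<close>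
  define up where "up z t i = map (\<lambda>k. canon U (\<lambda>n. t n i ! k)) [0..<length z]"
    for z :: "nat list" and t :: "nat \<Rightarrow> nat \<Rightarrow> 'a list" and i
  have len: "length (up z t i) = length z" for z t i by (simp add: up_def)
  have up: "up z t i \<in> tuples N z" if "\<And>n. i < n \<Longrightarrow> t n i \<in> tuples M z" for z t i
  proof -
    have "canon U (\<lambda>n. t n i ! k) \<in> dom_of N" if "k < length z" for k
      unfolding N_def
    proof (rule canon_in_ultrapower)
      show "\<forall>\<^sub>F n in U. t n i ! k \<in> dom_of M"
        using gt[of i]
      proof eventually_elim
        case (elim n)
        then have "t n i \<in> tuples M z" using \<open>\<And>n. i < n \<Longrightarrow> t n i \<in> tuples M z\<close> by blast
        then show ?case using \<open>k < length z\<close> by (auto simp: tuples_def)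
      qed
    qed
    then show ?thesis by (auto simp: tuples_def up_def)
  qed
  have proj: "\<forall>\<^sub>F n in U. map (\<lambda>f. f n) (up z t i) = t n i"
    if t: "\<And>n. i < n \<Longrightarrow> t n i \<in> tuples M z" for z t i
  proof -
    have "\<forall>\<^sub>F n in U. \<forall>k\<in>{..<length z}. canon U (\<lambda>n. t n i ! k) n = t n i ! k"
      by (intro eventually_ball_finite) (auto intro: eventually_canon)
    with gt[of i] show ?thesis
    proof eventually_elim
      case (elim n)
      then have "length (t n i) = length z" using t by (auto simp: tuples_def)
      then show ?case using elim(2) by (auto simp: up_def intro!: nth_equalityI)
    qed
  qed
  have aN: "up x a i \<in> tuples N x" and bN: "up y b i \<in> tuples N y" for i
    using up ab(1,2) by blast+
  have fv: "fv \<phi> \<subseteq> set (x @ y)" and wf: "wf_fm L \<phi>" using \<phi> by (auto simp: split_fm_def)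
  have N_order: "holds N \<phi> x (up x a i) y (up y b j) \<longleftrightarrow> i < j" for i j
  proof -
    let ?z = "up x a i @ up y b j"
    have lz: "length ?z = length (x @ y)" by (simp add: len)
    have projs: "\<forall>\<^sub>F n in U. map (\<lambda>f. f n) (up x a i) = a n i"
      "\<forall>\<^sub>F n in U. map (\<lambda>f. f n) (up y b j) = b n j"
      by (rule proj, erule ab)+
    have "holds N \<phi> x (up x a i) y (up y b j) \<longleftrightarrow>
        (\<forall>\<^sub>F n in U. sat M (\<lambda>k. assign (x @ y) ?z k n) \<phi>)"
      unfolding holds_def N_def
    proof (rule los[OF U(2)])
      fix k assume "k \<in> fv \<phi>"
      then have "assign (x @ y) ?z k \<in> set ?z" using fv by (intro assign_in_set[OF lz]) auto
      then show "assign (x @ y) ?z k \<in> dom_of (ultrapower U M)"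
        using aN[of i] bN[of j] by (auto simp: tuples_def N_def)
    qed
    also have "\<dots> \<longleftrightarrow> (\<forall>\<^sub>F n in U. i < j)"
    proof (rule eventually_subst)
      show "\<forall>\<^sub>F n in U. sat M (\<lambda>k. assign (x @ y) ?z k n) \<phi> \<longleftrightarrow> i < j"
        using gt[of i] gt[of j] projs
      proof eventually_elim
        case (elim n)
        have "sat M (\<lambda>k. assign (x @ y) ?z k n) \<phi> \<longleftrightarrow> holds M \<phi> x (a n i) y (b n j)"
          unfolding holds_def
        proof (rule sat_cong)
          fix k assume "k \<in> fv \<phi>"
          then have "assign (x @ y) (map (\<lambda>f. f n) ?z) k = assign (x @ y) ?z k n"
            using fv by (intro assign_map[OF lz]) auto
          then show "assign (x @ y) ?z k n = assign (x @ y) (a n i @ b n j) k"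
            using elim by simp
        qed
        then show ?case using ab(3) elim by simp
      qed
    qed
    also have "\<dots> \<longleftrightarrow> i < j" using U(2) by (simp add: ultrafilter_def eventually_const)
    finally show ?thesis .
  qed
  have strN: "is_struct L N" using M is_struct_ultrapower by (auto simp: model_of_def N_def)
  define X where "X = (\<Union>i. set (up x a i) \<union> set (up y b i))"
  \<comment> \<open>\<open>X\<close> is empty when \<open>x\<close> and \<open>y\<close> both are;
    adding \<open>e\<close> makes it possible to enumerate.\<close>
  obtain e where e: "e \<in> dom_of N" using strN by (auto simp: is_struct_def)
  have "countable (insert e X)" by (auto simp: X_def intro: countable_finite)
  then have rng: "range (from_nat_into (insert e X)) = insert e X" by (simp add: range_from_nat_into)
  have "insert e X \<subseteq> dom_of N" using aN bN e by (auto simp: X_def tuples_def)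
  then have "range (from_nat_into (insert e X)) \<subseteq> dom_of N" using rng by simp
  then obtain S :: "('f, 'r) small_struct" and h where S: "is_struct L S" "h ` dom_of S \<subseteq> dom_of N"
      "range (from_nat_into (insert e X)) \<subseteq> h ` dom_of S"
      "\<And>\<psi> v. wf_fm L \<psi> \<Longrightarrow> (\<And>n. n \<in> fv \<psi> \<Longrightarrow> v n \<in> dom_of S) \<Longrightarrow>
         sat S v \<psi> \<longleftrightarrow> sat N (\<lambda>n. h (v n)) \<psi>"
    using downward_loewenheim_skolem[OF strN] by metis
  have XS: "X \<subseteq> h ` dom_of S" using S(3) rng by auto
  have "model_of L T S"
    unfolding model_of_def satisfies_def
  proof (intro conjI ballI allI impI S(1))
    fix \<sigma> and v :: "nat \<Rightarrow> ('f, 'r) fm" assume \<sigma>: "\<sigma> \<in> T" and v: "range v \<subseteq> dom_of S"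
    have s: "wf_fm L \<sigma>" "fv \<sigma> = {}" using T[OF \<sigma>] by (auto simp: sentence_def)
    obtain m where m: "m \<in> dom_of M" using M by (auto simp: model_of_def is_struct_def)
    then have "sat M (\<lambda>_. m) \<sigma>" using M \<sigma> by (auto simp: model_of_def satisfies_def)
    \<comment> \<open>A sentence has one truth value for all assignments, so it passes through
      \<open>los\<close> to \<open>N\<close> and then to \<open>S\<close>.\<close>
    then have "sat M w \<sigma>" for w using sat_cong[of \<sigma> w "\<lambda>_. m" M] s(2) by simp
    then have "sat N w \<sigma>" for w using los[OF U(2), of \<sigma> w M] s(2) by (simp add: N_def)
    then show "sat S v \<sigma>" using S(4)[of \<sigma> v] s by simp
  qed
  moreover have "order_property S \<phi> x y"
  proof -
    define code where "code = inv_into (dom_of S) h"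
    have code: "code u \<in> dom_of S" "h (code u) = u" if "u \<in> X" for u
      using that XS by (auto simp: code_def inv_into_into f_inv_into_f)
    have aX: "set (up x a i) \<subseteq> X" and bX: "set (up y b i) \<subseteq> X" for i by (auto simp: X_def)
    have "holds S \<phi> x (map code (up x a i)) y (map code (up y b j)) \<longleftrightarrow> i < j" for i j
    proof -
      let ?z = "map code (up x a i) @ map code (up y b j)"
      have lz: "length ?z = length (x @ y)" by (simp add: len)
      have hz: "map h ?z = up x a i @ up y b j"
        using aX[of i] bX[of j] code(2) by (auto intro!: map_idI)
      have "holds S \<phi> x (map code (up x a i)) y (map code (up y b j))
          \<longleftrightarrow> sat N (\<lambda>k. h (assign (x @ y) ?z k)) \<phi>"
        unfolding holds_def
      proof (rule S(4)[OF wf])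
        fix k assume "k \<in> fv \<phi>"
        then have "assign (x @ y) ?z k \<in> set ?z" using fv by (intro assign_in_set[OF lz]) auto
        then show "assign (x @ y) ?z k \<in> dom_of S" using aX[of i] bX[of j] code(1) by auto
      qed
      also have "\<dots> \<longleftrightarrow> sat N (assign (x @ y) (map h ?z)) \<phi>"
        by (rule sat_cong, rule assign_map[OF lz, symmetric]) (use fv in auto)
      also have "\<dots> \<longleftrightarrow> i < j" using N_order[of i j] by (simp only: hz holds_def)
      finally show ?thesis .
    qed
    moreover have "map code (up x a i) \<in> tuples S x" "map code (up y b i) \<in> tuples S y" for i
      using aX[of i] bX[of i] code(1) by (auto simp: tuples_def len)
    ultimately show ?thesis
      unfolding order_property_def
      by (intro exI[of _ "\<lambda>i. map code (up x a i)"] exI[of _ "\<lambda>i. map code (up y b i)"]) simp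
  qed
  ultimately show ?thesis by blast
qed

theorem theorem3p11:
  fixes L :: "('f, 'r) language" and T :: "('f, 'r) fm set" and M :: "('a, 'f, 'r) struct"
    and \<phi> :: "('f, 'r) fm" and x y :: "nat list" and r s :: real
  assumes "complete_theory L T"
    and "stable_theory L T"
    and "model_of L T M"
    and "split_fm L \<phi> x y"
    and "r < s"
  shows "\<exists>N :: nat. \<not> (\<exists>\<mu> \<nu> :: nat \<Rightarrow> ('a, 'f, 'r) fm_measure.
           (\<forall>i\<in>{1..N}. average_measure M x (\<mu> i)) \<and>
           (\<forall>j\<in>{1..N}. average_measure M y (\<nu> j)) \<and>
           (\<forall>i\<in>{1..N}. \<forall>j\<in>{1..N}.
              if i < j then tensor M x y (\<mu> i) (\<nu> j) \<phi> \<le> r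
              else tensor M x y (\<mu> i) (\<nu> j) \<phi> \<ge> s))"
proof -
  define R where "R a b \<longleftrightarrow> holds M \<phi> x a y b" for a b
  let ?A = "tuples M x" and ?B = "tuples M y"
  have xy: "distinct (x @ y)" using assms(4) by (simp add: split_fm_def)
  \<comment> \<open>Half graphs of every length would yield a model of \<open>T\<close> on formulas
    with the order property, against stability.\<close>
  obtain n :: nat where n: "\<nexists>a b. (\<forall>i<n. a i \<in> ?A \<and> b i \<in> ?B) \<and>
      (\<forall>i<n. \<forall>j<n. holds M \<phi> x (a i) y (b j) \<longleftrightarrow> i < j)"
  proof (rule ccontr)
    assume no: "\<not> thesis"
    have "\<exists>S :: ('f, 'r) small_struct. model_of L T S \<and> order_property S \<phi> x y"
    proof (rule half_graphs_imp_order_property[OF _ assms(3,4)])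
      show "sentence L \<sigma>" if "\<sigma> \<in> T" for \<sigma>
        using assms(1) that by (simp add: complete_theory_def)
    qed (use no that in blast)
    then show False using assms(2,4) unfolding stable_theory_def by blast
  qed
  \<comment> \<open>A ladder has \<open>i \<le> j\<close> where the half graph has
    \<open>i < j\<close>; shifting \<open>a\<close> by one place, at the cost of one rung, converts
    it.\<close>
  have "\<not> ladder R (Suc n) ?A ?B"
  proof
    assume "ladder R (Suc n) ?A ?B"
    then obtain a b where ab: "\<forall>i<Suc n. a i \<in> ?A \<and> b i \<in> ?B \<and> (\<forall>j<Suc n. R (a i) (b j) \<longleftrightarrow> i \<le> j)"
      using ladder_sequences by blast
    show False
      using n[unfolded not_ex, rule_format, of "\<lambda>i. a (Suc i)" b] ab by (auto simp: R_def Suc_le_eq)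
  qed
  \<comment> \<open>Here \<open>R\<close> holds iff \<open>j < i\<close>, so reversing both
    sequences gives the half graph.\<close>
  moreover have "\<not> ladder (\<lambda>a b. \<not> R a b) n ?A ?B"
  proof
    assume "ladder (\<lambda>a b. \<not> R a b) n ?A ?B"
    then obtain a b where ab:
      "\<forall>i<n. a i \<in> ?A \<and> b i \<in> ?B \<and> (\<forall>j<n. \<not> R (a i) (b j) \<longleftrightarrow> i \<le> j)"
      using ladder_sequences by blast
    have "R (a (n - Suc i)) (b (n - Suc j)) \<longleftrightarrow> i < j" if "i < n" "j < n" for i j
    proof -
      have "\<not> R (a (n - Suc i)) (b (n - Suc j)) \<longleftrightarrow> n - Suc i \<le> n - Suc j"
        using ab that by simp
      then show ?thesis using that by linarith
    qed
    then show False
      using n[unfolded not_ex, rule_format, of "\<lambda>i. a (n - Suc i)" "\<lambda>j. b (n - Suc j)"] ab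
      by (auto simp: R_def)
  qed
  ultimately obtain d where d: "\<not> littlestone_ge R d ?A ?B"
    using littlestone_ge_ladder[of R "Suc n" n] by blast
  obtain N :: nat where N: "\<And>as bs. (\<forall>i\<in>{1..N}. as i \<noteq> [] \<and> set (as i) \<subseteq> ?A) \<Longrightarrow>
      (\<forall>j\<in>{1..N}. bs j \<noteq> [] \<and> set (bs j) \<subseteq> ?B) \<Longrightarrow>
      \<not> (\<forall>i\<in>{1..N}. \<forall>j\<in>{1..N}.
           if i < j then avg (as i) (\<lambda>a. avg (bs j) (\<lambda>b. of_bool (R a b))) \<le> r
           else avg (as i) (\<lambda>a. avg (bs j) (\<lambda>b. of_bool (R a b))) \<ge> s)"
    using averages_no_long_half_graph[OF d assms(5)] by blast
  have tensor: "tensor M x y (Ave M x as) (Ave M y bs) \<phi> = avg as (\<lambda>a. avg bs (\<lambda>b. of_bool (R a b)))"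
    if "as \<noteq> []" "set as \<subseteq> ?A" "bs \<noteq> []" "set bs \<subseteq> ?B" for as bs
    unfolding tensor_Ave[OF xy that] avg_def R_def sum_list_sum_nth
    by (simp add: atLeast0LessThan sum_divide_distrib mult.commute)
  show ?thesis
  proof (intro exI[of _ N] notI, elim exE conjE)
    fix \<mu> \<nu> :: "nat \<Rightarrow> ('a, 'f, 'r) fm_measure"
    assume \<mu>: "\<forall>i\<in>{1..N}. average_measure M x (\<mu> i)"
      and \<nu>: "\<forall>j\<in>{1..N}. average_measure M y (\<nu> j)"
      and half: "\<forall>i\<in>{1..N}. \<forall>j\<in>{1..N}.
              if i < j then tensor M x y (\<mu> i) (\<nu> j) \<phi> \<le> r
              else tensor M x y (\<mu> i) (\<nu> j) \<phi> \<ge> s"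
    obtain as where as: "\<forall>i\<in>{1..N}. as i \<noteq> [] \<and> set (as i) \<subseteq> ?A \<and> \<mu> i = Ave M x (as i)"
      using \<mu> unfolding average_measure_def by metis
    obtain bs where bs: "\<forall>j\<in>{1..N}. bs j \<noteq> [] \<and> set (bs j) \<subseteq> ?B \<and> \<nu> j = Ave M y (bs j)"
      using \<nu> unfolding average_measure_def by metis
    have eq: "tensor M x y (\<mu> i) (\<nu> j) \<phi> = avg (as i) (\<lambda>a. avg (bs j) (\<lambda>b. of_bool (R a b)))"
      if "i \<in> {1..N}" "j \<in> {1..N}" for i j
      using tensor as bs that by simp
    have "\<forall>i\<in>{1..N}. \<forall>j\<in>{1..N}.
        if i < j then avg (as i) (\<lambda>a. avg (bs j) (\<lambda>b. of_bool (R a b))) \<le> r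
        else avg (as i) (\<lambda>a. avg (bs j) (\<lambda>b. of_bool (R a b))) \<ge> s"
      using half eq by (metis (no_types, lifting))
    with N[of as bs] as bs show False by blast
  qed
qed

end
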